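(* Let $(X,\mathcal E)$ be the augmented tree of an IFS $\{S_i\}_{i=1}^N$ of contractive similitudes on $\mathbb R^d$ with self-similar set $K$, and suppose $(X,\mathcal E)$ is of bounded degree. Then the hyperbolic boundary $\partial X$ (equivalently, the self-similar set $K$) is totally disconnected if and only if the sizes $\#T$ of the horizontal components $T$ of $X$ are uniformly bounded. The same holds with $X$ replaced by its quotient space $X^\sim$: if $(X^\sim,\mathcal E)$ is of bounded degree, then $\partial X^\sim$ (equivalently, $K$) is totally disconnected if and only if the sizes of the horizontal components of $X^\sim$ are uniformly bounded.
   Context: **Augmented tree.** Let $\{S_i\}_{i=1}^N$ be an IFS of contractive similitudes on $\mathbb R^d$, $S_i$ having contraction ratio $r_i\in(0,1)$, and let $K$ be its self-similar set, i.e. the unique non-empty compact set with $K=\bigcup_{i=1}^N S_i(K)$. Let $\Sigma=\{1,\dots,N\}$ and let $\Sigma^*$ be the set of finite words over $\Sigma$, including the empty word $\vartheta$. For $x=i_1\cdots i_k\in\Sigma^*$ put $S_x=S_{i_1}\circ\cdots\circ S_{i_k}$ and $r_x=r_{i_1}\cdots r_{i_k}$. Let $r=\min_i r_i$, $X_0=\{\vartheta\}$, $X_n=\{x=i_1\cdots i_k\in\Sigma^*: r_x\le r^n<r_{i_1}\cdots r_{i_{k-1}}\}$ for $n\ge1$, and $X=\bigcup_{n\ge0}X_n$. If $x\in X_n$ write $|x|=n$. For each $y\in X_n$, $n\ge1$, there is a unique prefix $x\in X_{n-1}$ of $y$, its parent; $\mathcal E_v$ is the (symmetric) set of edges joining a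 vertex to its parent. Fix $\kappa>0$ and let $\mathcal E_h=\{(x,y): |x|=|y|,\ x\ne y,\ \mathrm{dist}(S_x(K),S_y(K))\le\kappa r^{|x|}\}$, $\mathcal E=\mathcal E_v\cup\mathcal E_h$. The graph $(X,\mathcal E)$ with root $\vartheta$ is the augmented tree. **Quotient space.** $X^\sim$ is the quotient of $X$ by the relation identifying $x,y$ when $|x|=|y|$ and $S_x=S_y$, with the induced edges (two distinct classes are joined by a vertical, resp. horizontal, edge if some representatives are), still denoted $\mathcal E_v,\mathcal E_h,\mathcal E=\mathcal E_v\cup\mathcal E_h$. **Terminology.** A graph is of bounded degree if $\sup_x\#\{y:(x,y)\in\mathcal E\}<\infty$. A horizontal component is a maximal subset of some level that is connected with respect to $\mathcal E_h$. **Hyperbolic boundary.** For a connected graph with root $\vartheta$ and graph distance $d$, let $|x|=d(\vartheta,x)$ and $|x\wedge y|=\frac12(|x|+|y|-d(x,y))$. The graph is hyperbolic if there is $\delta\ge0$ with $|x\wedge y|\ge\min\{|x\wedge z|,|z\wedge y|\}-\delta$ for all $x,y,z$. It is known that $(X,\mathcal E)$ and $(X^\sim,\mathcal E)$ are hyperbolic. For $a>0$ let $\rho_a(x,x)=0$ and $\rho_a(x,y)=\exp(-a|x\wedge y|)$ for $x\ne y$; for $a$ small ($\exp(3\delta a)<\sqrt2$) $\rho_a$ is equivalent (up to multiplicative constants) to a metric, called a visual metric. The hyperbolic boundary is $\partial X=\overline X\setminus X$, where $\overline X$ is the $\rho_a$-completion of $X$ (similarly for $X^\sim$). *)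

theory Defs
  imports "HOL-Analysis.Analysis" "HOL-Library.Sublist"
begin

section \<open>Iterated function systems of similitudes\<close>

definition similitude_IFS ::
    "nat \<Rightarrow> (nat \<Rightarrow> 'a::metric_space \<Rightarrow> 'a) \<Rightarrow> (nat \<Rightarrow> real) \<Rightarrow> bool" where
  "similitude_IFS N S r \<longleftrightarrow>
     1 \<le> N \<and>
     (\<forall>i\<in>{1..N}. 0 < r i \<and> r i < 1 \<and> (\<forall>p q. dist (S i p) (S i q) = r i * dist p q))"

definition self_similar_set ::
    "nat \<Rightarrow> (nat \<Rightarrow> 'a::metric_space \<Rightarrow> 'a) \<Rightarrow> 'a set \<Rightarrow> bool" where
  "self_similar_set N S K \<longleftrightarrow> compact K \<and> K \<noteq> {} \<and> K = (\<Union>i\<in>{1..N}. S i ` K)"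

definition word_map :: "(nat \<Rightarrow> 'a \<Rightarrow> 'a) \<Rightarrow> nat list \<Rightarrow> 'a \<Rightarrow> 'a" where
  "word_map S w = foldr (\<lambda>i g. S i \<circ> g) w id"

definition word_ratio :: "(nat \<Rightarrow> real) \<Rightarrow> nat list \<Rightarrow> real" where
  "word_ratio r w = prod_list (map r w)"

definition min_ratio :: "nat \<Rightarrow> (nat \<Rightarrow> real) \<Rightarrow> real" where
  "min_ratio N r = Min (r ` {1..N})"


section \<open>The augmented tree\<close>

definition aug_level :: "nat \<Rightarrow> (nat \<Rightarrow> real) \<Rightarrow> nat \<Rightarrow> nat list set" where
  "aug_level N r n =
     (if n = 0 then {[]}
      else {w. set w \<subseteq> {1..N} \<and> w \<noteq> [] \<and>
               word_ratio r w \<le> min_ratio N r ^ n \<and>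
               min_ratio N r ^ n < word_ratio r (butlast w)})"

definition aug_verts :: "nat \<Rightarrow> (nat \<Rightarrow> real) \<Rightarrow> nat list set" where
  "aug_verts N r = (\<Union>n. aug_level N r n)"

definition aug_vert_edges :: "nat \<Rightarrow> (nat \<Rightarrow> real) \<Rightarrow> (nat list \<times> nat list) set" where
  "aug_vert_edges N r =
     (let P = {(x, y). \<exists>n. x \<in> aug_level N r n \<and> y \<in> aug_level N r (Suc n) \<and> prefix x y}
      in P \<union> P\<inverse>)"

definition aug_hor_edges ::
    "nat \<Rightarrow> (nat \<Rightarrow> 'a::metric_space \<Rightarrow> 'a) \<Rightarrow> (nat \<Rightarrow> real) \<Rightarrow> 'a set \<Rightarrow> real
      \<Rightarrow> (nat list \<times> nat list) set" where
  "aug_hor_edges N S r K \<kappa> =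
     {(x, y). x \<noteq> y \<and> (\<exists>n. x \<in> aug_level N r n \<and> y \<in> aug_level N r n \<and>
        setdist (word_map S x ` K) (word_map S y ` K) \<le> \<kappa> * min_ratio N r ^ n)}"

definition aug_edges ::
    "nat \<Rightarrow> (nat \<Rightarrow> 'a::metric_space \<Rightarrow> 'a) \<Rightarrow> (nat \<Rightarrow> real) \<Rightarrow> 'a set \<Rightarrow> real
      \<Rightarrow> (nat list \<times> nat list) set" where
  "aug_edges N S r K \<kappa> = aug_vert_edges N r \<union> aug_hor_edges N S r K \<kappa>"


section \<open>The quotient of the augmented tree\<close>

definition aug_rel ::
    "nat \<Rightarrow> (nat \<Rightarrow> 'a \<Rightarrow> 'a) \<Rightarrow> (nat \<Rightarrow> real) \<Rightarrow> (nat list \<times> nat list) set" where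
  "aug_rel N S r =
     {(x, y). \<exists>n. x \<in> aug_level N r n \<and> y \<in> aug_level N r n \<and> word_map S x = word_map S y}"

definition quot_level ::
    "nat \<Rightarrow> (nat \<Rightarrow> 'a \<Rightarrow> 'a) \<Rightarrow> (nat \<Rightarrow> real) \<Rightarrow> nat \<Rightarrow> nat list set set" where
  "quot_level N S r n = aug_level N r n // aug_rel N S r"

definition quot_verts ::
    "nat \<Rightarrow> (nat \<Rightarrow> 'a \<Rightarrow> 'a) \<Rightarrow> (nat \<Rightarrow> real) \<Rightarrow> nat list set set" where
  "quot_verts N S r = aug_verts N r // aug_rel N S r"

definition quot_root ::
    "nat \<Rightarrow> (nat \<Rightarrow> 'a \<Rightarrow> 'a) \<Rightarrow> (nat \<Rightarrow> real) \<Rightarrow> nat list set" where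
  "quot_root N S r = aug_rel N S r `` {[]}"

definition induced_edges :: "'v set set \<Rightarrow> ('v \<times> 'v) set \<Rightarrow> ('v set \<times> 'v set) set" where
  "induced_edges Q E = {(C, D). C \<in> Q \<and> D \<in> Q \<and> C \<noteq> D \<and> (\<exists>x\<in>C. \<exists>y\<in>D. (x, y) \<in> E)}"

definition quot_vert_edges ::
    "nat \<Rightarrow> (nat \<Rightarrow> 'a \<Rightarrow> 'a) \<Rightarrow> (nat \<Rightarrow> real) \<Rightarrow> (nat list set \<times> nat list set) set" where
  "quot_vert_edges N S r = induced_edges (quot_verts N S r) (aug_vert_edges N r)"

definition quot_hor_edges ::
    "nat \<Rightarrow> (nat \<Rightarrow> 'a::metric_space \<Rightarrow> 'a) \<Rightarrow> (nat \<Rightarrow> real) \<Rightarrow> 'a set \<Rightarrow> real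
      \<Rightarrow> (nat list set \<times> nat list set) set" where
  "quot_hor_edges N S r K \<kappa> = induced_edges (quot_verts N S r) (aug_hor_edges N S r K \<kappa>)"

definition quot_edges ::
    "nat \<Rightarrow> (nat \<Rightarrow> 'a::metric_space \<Rightarrow> 'a) \<Rightarrow> (nat \<Rightarrow> real) \<Rightarrow> 'a set \<Rightarrow> real
      \<Rightarrow> (nat list set \<times> nat list set) set" where
  "quot_edges N S r K \<kappa> = quot_vert_edges N S r \<union> quot_hor_edges N S r K \<kappa>"


section \<open>Graph terminology\<close>

definition bounded_degree :: "'v set \<Rightarrow> ('v \<times> 'v) set \<Rightarrow> bool" where
  "bounded_degree V E \<longleftrightarrow> (\<exists>M. \<forall>x\<in>V. finite {y. (x, y) \<in> E} \<and> card {y. (x, y) \<in> E} \<le> M)"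

definition edge_connected :: "('v \<times> 'v) set \<Rightarrow> 'v set \<Rightarrow> bool" where
  "edge_connected E T \<longleftrightarrow> T \<noteq> {} \<and> (\<forall>x\<in>T. \<forall>y\<in>T. (x, y) \<in> (E \<inter> T \<times> T)\<^sup>*)"

definition horizontal_component ::
    "(nat \<Rightarrow> 'v set) \<Rightarrow> ('v \<times> 'v) set \<Rightarrow> 'v set \<Rightarrow> bool" where
  "horizontal_component L Eh T \<longleftrightarrow>
     (\<exists>n. T \<subseteq> L n \<and> edge_connected Eh T \<and>
          (\<forall>T'. T \<subseteq> T' \<and> T' \<subseteq> L n \<and> edge_connected Eh T' \<longrightarrow> T' = T))"

definition bounded_horizontal_components ::
    "(nat \<Rightarrow> 'v set) \<Rightarrow> ('v \<times> 'v) set \<Rightarrow> bool" where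
  "bounded_horizontal_components L Eh \<longleftrightarrow>
     (\<exists>M. \<forall>T. horizontal_component L Eh T \<longrightarrow> finite T \<and> card T \<le> M)"

text \<open>Length of a shortest path; only meaningful for vertices in the same connected component.\<close>

definition graph_dist :: "('v \<times> 'v) set \<Rightarrow> 'v \<Rightarrow> 'v \<Rightarrow> nat" where
  "graph_dist E x y = (LEAST n. (x, y) \<in> E ^^ n)"

definition gromov_product :: "('v \<times> 'v) set \<Rightarrow> 'v \<Rightarrow> 'v \<Rightarrow> 'v \<Rightarrow> real" where
  "gromov_product E o\<^sub>r x y =
     (real (graph_dist E o\<^sub>r x) + real (graph_dist E o\<^sub>r y) - real (graph_dist E x y)) / 2"

definition gromov_rho :: "real \<Rightarrow> ('v \<times> 'v) set \<Rightarrow> 'v \<Rightarrow> 'v \<Rightarrow> 'v \<Rightarrow> real" where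
  "gromov_rho a E o\<^sub>r x y = (if x = y then 0 else exp (- a * gromov_product E o\<^sub>r x y))"


section \<open>Completion and boundary\<close>

text \<open>
  The completion with respect to a function \<open>\<rho>\<close> that is only equivalent, up to multiplicative
  constants, to a metric: Cauchy sequences of points of \<open>V\<close> modulo \<open>\<rho> (x n) (y n) \<longlonglongrightarrow> 0\<close>.
\<close>

definition cauchy_seqs :: "'v set \<Rightarrow> ('v \<Rightarrow> 'v \<Rightarrow> real) \<Rightarrow> (nat \<Rightarrow> 'v) set" where
  "cauchy_seqs V \<rho> =
     {x. range x \<subseteq> V \<and> (\<forall>\<epsilon>>0. \<exists>M. \<forall>m\<ge>M. \<forall>n\<ge>M. \<rho> (x m) (x n) < \<epsilon>)}"

definition cauchy_rel ::
    "'v set \<Rightarrow> ('v \<Rightarrow> 'v \<Rightarrow> real) \<Rightarrow> ((nat \<Rightarrow> 'v) \<times> (nat \<Rightarrow> 'v)) set" where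
  "cauchy_rel V \<rho> =
     {(x, y). x \<in> cauchy_seqs V \<rho> \<and> y \<in> cauchy_seqs V \<rho> \<and> (\<lambda>n. \<rho> (x n) (y n)) \<longlonglongrightarrow> 0}"

definition seq_completion :: "'v set \<Rightarrow> ('v \<Rightarrow> 'v \<Rightarrow> real) \<Rightarrow> (nat \<Rightarrow> 'v) set set" where
  "seq_completion V \<rho> = cauchy_seqs V \<rho> // cauchy_rel V \<rho>"

definition completion_embed ::
    "'v set \<Rightarrow> ('v \<Rightarrow> 'v \<Rightarrow> real) \<Rightarrow> 'v \<Rightarrow> (nat \<Rightarrow> 'v) set" where
  "completion_embed V \<rho> v = cauchy_rel V \<rho> `` {\<lambda>_. v}"

text \<open>
  Since \<open>\<rho>\<close> need not be continuous, \<open>\<rho> (x n) (y n)\<close> need not converge; the neighbourhood of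
  radius \<open>\<epsilon>\<close> of \<open>\<xi>\<close> consists of the \<open>\<eta>\<close> for which \<open>\<rho> (x n) (y n)\<close> is eventually below
  \<open>\<epsilon>\<close> for some representatives.  By \<open>metric_completion_of.homeomorphic_completion\<close>, the resulting
  topology is that of the metric completion for every metric equivalent to \<open>\<rho>\<close>.
\<close>

definition completion_near ::
    "('v \<Rightarrow> 'v \<Rightarrow> real) \<Rightarrow> real \<Rightarrow> (nat \<Rightarrow> 'v) set \<Rightarrow> (nat \<Rightarrow> 'v) set \<Rightarrow> bool" where
  "completion_near \<rho> \<epsilon> \<xi> \<eta> \<longleftrightarrow>
     (\<exists>x\<in>\<xi>. \<exists>y\<in>\<eta>. eventually (\<lambda>n. \<rho> (x n) (y n) < \<epsilon>) sequentially)"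

definition completion_open ::
    "'v set \<Rightarrow> ('v \<Rightarrow> 'v \<Rightarrow> real) \<Rightarrow> (nat \<Rightarrow> 'v) set set \<Rightarrow> bool" where
  "completion_open V \<rho> U \<longleftrightarrow>
     U \<subseteq> seq_completion V \<rho> \<and>
     (\<forall>\<xi>\<in>U. \<exists>\<epsilon>>0. \<forall>\<eta>\<in>seq_completion V \<rho>. completion_near \<rho> \<epsilon> \<xi> \<eta> \<longrightarrow> \<eta> \<in> U)"

definition completion_topology ::
    "'v set \<Rightarrow> ('v \<Rightarrow> 'v \<Rightarrow> real) \<Rightarrow> (nat \<Rightarrow> 'v) set topology" where
  "completion_topology V \<rho> = topology (completion_open V \<rho>)"

definition completion_boundary ::
    "'v set \<Rightarrow> ('v \<Rightarrow> 'v \<Rightarrow> real) \<Rightarrow> (nat \<Rightarrow> 'v) set topology" where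
  "completion_boundary V \<rho> =
     subtopology (completion_topology V \<rho>) (seq_completion V \<rho> - completion_embed V \<rho> ` V)"

text \<open>
  For a hyperbolic graph and small \<open>a > 0\<close>, \<open>gromov_rho\<close> is equivalent to a visual metric and
  this is the boundary of the completion.  For \<open>a > 0\<close>, neither the Cauchy sequences nor the
  topology depend on \<open>a\<close>, because \<open>gromov_rho (t * a) = gromov_rho a powr t\<close> for \<open>t > 0\<close>.
\<close>

definition hyperbolic_boundary ::
    "real \<Rightarrow> 'v set \<Rightarrow> ('v \<times> 'v) set \<Rightarrow> 'v \<Rightarrow> (nat \<Rightarrow> 'v) set topology" where
  "hyperbolic_boundary a V E o\<^sub>r = completion_boundary V (gromov_rho a E o\<^sub>r)"

definition totally_disconnected_space :: "'b topology \<Rightarrow> bool" where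
  "totally_disconnected_space T \<longleftrightarrow> (\<forall>x\<in>topspace T. connected_component_of_set T x = {x})"

lemma completion_near_mono:
  "completion_near \<rho> \<delta> \<xi> \<eta> \<Longrightarrow> \<delta> \<le> \<epsilon> \<Longrightarrow> completion_near \<rho> \<epsilon> \<xi> \<eta>"
  unfolding completion_near_def
  by (elim bexE, intro bexI) (erule eventually_mono, auto)

lemma istopology_completion_open: "istopology (completion_open V \<rho>)"
  unfolding istopology_def
proof (intro conjI allI impI)
  fix A B assume A: "completion_open V \<rho> A" and B: "completion_open V \<rho> B"
  have "\<exists>\<epsilon>>0. \<forall>\<eta>\<in>seq_completion V \<rho>. completion_near \<rho> \<epsilon> \<xi> \<eta> \<longrightarrow> \<eta> \<in> A \<inter> B"
    if \<xi>: "\<xi> \<in> A \<inter> B" for \<xi>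
  proof -
    obtain e1 e2 where "e1 > 0" "e2 > 0"
      and "\<forall>\<eta>\<in>seq_completion V \<rho>. completion_near \<rho> e1 \<xi> \<eta> \<longrightarrow> \<eta> \<in> A"
      and "\<forall>\<eta>\<in>seq_completion V \<rho>. completion_near \<rho> e2 \<xi> \<eta> \<longrightarrow> \<eta> \<in> B"
      using A B \<xi> unfolding completion_open_def by blast
    moreover have "completion_near \<rho> e1 \<xi> \<eta> \<and> completion_near \<rho> e2 \<xi> \<eta>"
      if "completion_near \<rho> (min e1 e2) \<xi> \<eta>" for \<eta>
      using completion_near_mono[OF that, of e1] completion_near_mono[OF that, of e2] by simp
    moreover have "min e1 e2 > 0" using \<open>e1 > 0\<close> \<open>e2 > 0\<close> by simp
    ultimately show ?thesis by blast
  qed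
  then show "completion_open V \<rho> (A \<inter> B)"
    using A unfolding completion_open_def by blast
next
  fix \<U> assume "\<forall>U\<in>\<U>. completion_open V \<rho> U"
  then show "completion_open V \<rho> (\<Union>\<U>)"
    unfolding completion_open_def by (fastforce simp: Sup_le_iff)
qed

lemma openin_completion_topology: "openin (completion_topology V \<rho>) U \<longleftrightarrow> completion_open V \<rho> U"
  unfolding completion_topology_def using istopology_completion_open topology_inverse' by metis

lemma topspace_completion_topology: "topspace (completion_topology V \<rho>) = seq_completion V \<rho>"
proof -
  have "openin (completion_topology V \<rho>) (seq_completion V \<rho>)"
    unfolding openin_completion_topology completion_open_def by (auto intro: exI[of _ 1])
  then show ?thesis
    by (metis completion_open_def openin_completion_topology openin_subset openin_topspace subset_antisym)
qed

locale metric_completion_of =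
  X: Metric_space V \<theta> + Y: Metric_space Y D
  for V :: "'v set" and \<theta> and Y :: "'y set" and D +
  fixes \<rho> :: "'v \<Rightarrow> 'v \<Rightarrow> real" and c C :: real and f :: "'v \<Rightarrow> 'y"
  assumes c: "c > 0" and C: "C > 0"
    and lower: "\<And>x y. x \<in> V \<Longrightarrow> y \<in> V \<Longrightarrow> c * \<rho> x y \<le> \<theta> x y"
    and upper: "\<And>x y. x \<in> V \<Longrightarrow> y \<in> V \<Longrightarrow> \<theta> x y \<le> C * \<rho> x y"
    and complete: "Y.mcomplete"
    and f: "f ` V \<subseteq> Y"
    and isom: "\<And>x y. x \<in> V \<Longrightarrow> y \<in> V \<Longrightarrow> D (f x) (f y) = \<theta> x y"
    and dense: "Y.mtopology closure_of (f ` V) = Y"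
begin

definition lim_of :: "(nat \<Rightarrow> 'v) \<Rightarrow> 'y" where
  "lim_of x = (SOME l. l \<in> Y \<and> (\<lambda>n. D (f (x n)) l) \<longlonglongrightarrow> 0)"

lemma rho_less: "x \<in> V \<Longrightarrow> y \<in> V \<Longrightarrow> \<theta> x y < c * e \<Longrightarrow> \<rho> x y < e"
  using lower[of x y] c by (smt (verit) mult_le_cancel_left_pos)

lemma theta_less: "x \<in> V \<Longrightarrow> y \<in> V \<Longrightarrow> \<rho> x y < e \<Longrightarrow> \<theta> x y < C * e"
  using upper[of x y] C by (smt (verit) mult_less_cancel_left_pos)

lemma rho_nonneg: "x \<in> V \<Longrightarrow> y \<in> V \<Longrightarrow> 0 \<le> \<rho> x y"
  using upper[of x y] X.nonneg[of x y] C by (smt (verit) mult_pos_neg)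

lemma rho_tendsto_iff:
  assumes "range x \<subseteq> V" "range y \<subseteq> V"
  shows "(\<lambda>n. \<rho> (x n) (y n)) \<longlonglongrightarrow> 0 \<longleftrightarrow> (\<lambda>n. \<theta> (x n) (y n)) \<longlonglongrightarrow> 0"
proof
  have V: "x n \<in> V" "y n \<in> V" for n using assms by auto
  show "(\<lambda>n. \<theta> (x n) (y n)) \<longlonglongrightarrow> 0" if "(\<lambda>n. \<rho> (x n) (y n)) \<longlonglongrightarrow> 0"
    by (rule tendsto_sandwich[of "\<lambda>_. 0" _ _ "\<lambda>n. C * \<rho> (x n) (y n)"])
      (use that V upper in \<open>auto intro!: tendsto_mult_right_zero\<close>)
  show "(\<lambda>n. \<rho> (x n) (y n)) \<longlonglongrightarrow> 0" if "(\<lambda>n. \<theta> (x n) (y n)) \<longlonglongrightarrow> 0"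
  proof (rule tendsto_sandwich[of "\<lambda>_. 0" _ _ "\<lambda>n. \<theta> (x n) (y n) / c"])
    show "\<forall>\<^sub>F n in sequentially. \<rho> (x n) (y n) \<le> \<theta> (x n) (y n) / c"
      using V lower c by (auto simp: field_simps)
    show "(\<lambda>n. \<theta> (x n) (y n) / c) \<longlonglongrightarrow> 0"
      using tendsto_divide_zero[OF that] .
  qed (use V rho_nonneg in auto)
qed

lemma cauchy_limit:
  assumes "x \<in> cauchy_seqs V \<rho>"
  shows "lim_of x \<in> Y" "(\<lambda>n. D (f (x n)) (lim_of x)) \<longlonglongrightarrow> 0"
proof -
  have V: "x n \<in> V" for n using assms by (auto simp: cauchy_seqs_def)
  have "Y.MCauchy (f \<circ> x)"
    unfolding Y.MCauchy_def
  proof (intro conjI allI impI)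
    show "range (f \<circ> x) \<subseteq> Y" using V f by auto
    fix e :: real assume "e > 0"
    then have "e / C > 0" using C by simp
    then obtain M where "\<forall>m\<ge>M. \<forall>n\<ge>M. \<rho> (x m) (x n) < e / C"
      using assms unfolding cauchy_seqs_def by blast
    then have "\<forall>n n'. M \<le> n \<longrightarrow> M \<le> n' \<longrightarrow> D ((f \<circ> x) n) ((f \<circ> x) n') < e"
      using theta_less[OF V V, of _ _ "e / C"] C isom V by (auto simp: field_simps)
    then show "\<exists>M. \<forall>n n'. M \<le> n \<longrightarrow> M \<le> n' \<longrightarrow> D ((f \<circ> x) n) ((f \<circ> x) n') < e" ..
  qed
  then obtain l where "limitin Y.mtopology (f \<circ> x) l sequentially"
    using complete unfolding Y.mcomplete_def by blast
  then have "l \<in> Y \<and> (\<lambda>n. D (f (x n)) l) \<longlonglongrightarrow> 0"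
    by (simp add: Y.limit_metric_sequentially LIMSEQ_def dist_real_def o_def) blast
  then have "lim_of x \<in> Y \<and> (\<lambda>n. D (f (x n)) (lim_of x)) \<longlonglongrightarrow> 0"
    unfolding lim_of_def by (rule someI)
  then show "lim_of x \<in> Y" "(\<lambda>n. D (f (x n)) (lim_of x)) \<longlonglongrightarrow> 0" by auto
qed

lemma dist_limit:
  assumes x: "x \<in> cauchy_seqs V \<rho>" and y: "y \<in> cauchy_seqs V \<rho>"
  shows "(\<lambda>n. \<theta> (x n) (y n)) \<longlonglongrightarrow> D (lim_of x) (lim_of y)"
proof -
  have V: "x n \<in> V" "y n \<in> V" for n using assms by (auto simp: cauchy_seqs_def)
  note lx = cauchy_limit[OF x] and ly = cauchy_limit[OF y]
  have b: "\<bar>\<theta> (x n) (y n) - D (lim_of x) (lim_of y)\<bar>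
      \<le> D (f (x n)) (lim_of x) + D (f (y n)) (lim_of y)" for n
  proof -
    have m: "f (x n) \<in> Y" "f (y n) \<in> Y" using V f by auto
    have "D (f (x n)) (f (y n)) \<le> D (f (x n)) (lim_of x) + D (lim_of x) (f (y n))"
      "D (lim_of x) (f (y n)) \<le> D (lim_of x) (lim_of y) + D (lim_of y) (f (y n))"
      "D (lim_of x) (lim_of y) \<le> D (lim_of x) (f (x n)) + D (f (x n)) (lim_of y)"
      "D (f (x n)) (lim_of y) \<le> D (f (x n)) (f (y n)) + D (f (y n)) (lim_of y)"
      using m lx(1) ly(1) by (auto intro!: Y.triangle)
    then show ?thesis
      using isom[OF V] by (simp add: Y.commute)
  qed
  have l: "(\<lambda>n. D (f (x n)) (lim_of x) + D (f (y n)) (lim_of y)) \<longlonglongrightarrow> 0"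
    using tendsto_add[OF lx(2) ly(2)] by simp
  have "(\<lambda>n. \<theta> (x n) (y n) - D (lim_of x) (lim_of y)) \<longlonglongrightarrow> 0"
  proof (rule Lim_null_comparison[OF _ l], rule always_eventually, rule allI)
    fix n show "norm (\<theta> (x n) (y n) - D (lim_of x) (lim_of y))
        \<le> D (f (x n)) (lim_of x) + D (f (y n)) (lim_of y)"
      unfolding real_norm_def by (rule b)
  qed
  then show ?thesis by (rule LIM_zero_cancel)
qed

lemma cauchy_rel_iff:
  assumes "x \<in> cauchy_seqs V \<rho>" "y \<in> cauchy_seqs V \<rho>"
  shows "(x, y) \<in> cauchy_rel V \<rho> \<longleftrightarrow> lim_of x = lim_of y"
proof -
  have "range x \<subseteq> V" "range y \<subseteq> V" using assms by (auto simp: cauchy_seqs_def)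
  then have "(x, y) \<in> cauchy_rel V \<rho> \<longleftrightarrow> (\<lambda>n. \<theta> (x n) (y n)) \<longlonglongrightarrow> 0"
    using assms rho_tendsto_iff unfolding cauchy_rel_def by auto
  also have "\<dots> \<longleftrightarrow> D (lim_of x) (lim_of y) = 0"
    using dist_limit[OF assms] LIMSEQ_unique by metis
  also have "\<dots> \<longleftrightarrow> lim_of x = lim_of y"
    using cauchy_limit(1) assms by simp
  finally show ?thesis .
qed

definition h :: "(nat \<Rightarrow> 'v) set \<Rightarrow> 'y" where
  "h \<xi> = lim_of (SOME x. x \<in> \<xi>)"

lemma class_eq:
  assumes "x \<in> cauchy_seqs V \<rho>"
  shows "cauchy_rel V \<rho> `` {x} = {y \<in> cauchy_seqs V \<rho>. lim_of y = lim_of x}"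
  using cauchy_rel_iff[OF assms] unfolding cauchy_rel_def by fastforce

lemma h_class:
  assumes "x \<in> cauchy_seqs V \<rho>"
  shows "h (cauchy_rel V \<rho> `` {x}) = lim_of x"
proof -
  have "\<exists>y. y \<in> cauchy_rel V \<rho> `` {x}" using class_eq[OF assms] assms by auto
  then have "(SOME y. y \<in> cauchy_rel V \<rho> `` {x}) \<in> cauchy_rel V \<rho> `` {x}" by (rule someI_ex)
  then show ?thesis unfolding h_def using class_eq[OF assms] by simp
qed

lemma h_mem:
  assumes "\<xi> \<in> seq_completion V \<rho>" "x \<in> \<xi>"
  shows "x \<in> cauchy_seqs V \<rho>" "h \<xi> = lim_of x"
proof -
  obtain z where z: "z \<in> cauchy_seqs V \<rho>" "\<xi> = cauchy_rel V \<rho> `` {z}"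
    using assms(1) unfolding seq_completion_def by (rule quotientE) auto
  then show "x \<in> cauchy_seqs V \<rho>" "h \<xi> = lim_of x"
    using assms(2) class_eq[OF z(1)] h_class[OF z(1)] by auto
qed

lemma ex_rep:
  assumes "\<xi> \<in> seq_completion V \<rho>" obtains x where "x \<in> \<xi>"
proof -
  obtain z where z: "z \<in> cauchy_seqs V \<rho>" "\<xi> = cauchy_rel V \<rho> `` {z}"
    using assms(1) unfolding seq_completion_def by (rule quotientE) auto
  then have "z \<in> \<xi>" using class_eq by auto
  then show ?thesis by (rule that)
qed

lemma theta_cauchy:
  assumes "range x \<subseteq> V" "l \<in> Y" "(\<lambda>n. D (f (x n)) l) \<longlonglongrightarrow> 0"
  shows "x \<in> cauchy_seqs V \<rho>" "lim_of x = l"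
proof -
  have V: "x n \<in> V" for n using assms by auto
  have "\<exists>M. \<forall>m\<ge>M. \<forall>n\<ge>M. \<rho> (x m) (x n) < e" if "e > 0" for e
  proof -
    have "c * e / 2 > 0" using c that by simp
    then obtain M where M: "\<forall>n\<ge>M. D (f (x n)) l < c * e / 2"
      using order_tendstoD(2)[OF assms(3)] unfolding eventually_sequentially by blast
    have "\<rho> (x m) (x n) < e" if "m \<ge> M" "n \<ge> M" for m n
    proof (rule rho_less[OF V V])
      have "D (f (x m)) (f (x n)) \<le> D (f (x m)) l + D l (f (x n))"
        using V f assms(2) by (intro Y.triangle) auto
      moreover have "D (f (x m)) l < c * e / 2" "D l (f (x n)) < c * e / 2"
        using M that by (auto simp: Y.commute)
      ultimately show "\<theta> (x m) (x n) < c * e"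
        using isom[OF V V, of m n] by linarith
    qed
    then show ?thesis by blast
  qed
  then show x: "x \<in> cauchy_seqs V \<rho>" using assms(1) unfolding cauchy_seqs_def by auto
  have "D (lim_of x) l \<le> D (f (x n)) (lim_of x) + D (f (x n)) l" for n
    using Y.triangle[of "lim_of x" "f (x n)" l] cauchy_limit(1)[OF x] assms(2) V f
    by (auto simp: Y.commute)
  moreover have "(\<lambda>n. D (f (x n)) (lim_of x) + D (f (x n)) l) \<longlonglongrightarrow> 0"
    using tendsto_add[OF cauchy_limit(2)[OF x] assms(3)] by simp
  ultimately have "D (lim_of x) l \<le> 0"
    by (intro LIMSEQ_le_const) auto
  then show "lim_of x = l"
    using Y.nonneg[of "lim_of x" l] Y.zero[OF cauchy_limit(1)[OF x] assms(2)] by linarith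
qed

lemma h_embed:
  assumes "v \<in> V"
  shows "h (completion_embed V \<rho> v) = f v" "completion_embed V \<rho> v \<in> seq_completion V \<rho>"
proof -
  have fv: "f v \<in> Y" using assms f by auto
  then have "D (f v) (f v) = 0" by simp
  then have "(\<lambda>n::nat. v) \<in> cauchy_seqs V \<rho>" "lim_of (\<lambda>n. v) = f v"
    using theta_cauchy[of "\<lambda>_. v" "f v"] assms fv by auto
  then show "h (completion_embed V \<rho> v) = f v" "completion_embed V \<rho> v \<in> seq_completion V \<rho>"
    unfolding completion_embed_def seq_completion_def using h_class by (auto intro: quotientI)
qed

lemma h_bij: "bij_betw h (seq_completion V \<rho>) Y"
  unfolding bij_betw_def
proof (intro conjI set_eqI iffI)
  show "inj_on h (seq_completion V \<rho>)"
  proof (rule inj_onI)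
    fix \<xi> \<eta> assume a: "\<xi> \<in> seq_completion V \<rho>" "\<eta> \<in> seq_completion V \<rho>" "h \<xi> = h \<eta>"
    obtain x y where xy: "x \<in> cauchy_seqs V \<rho>" "\<xi> = cauchy_rel V \<rho> `` {x}"
      "y \<in> cauchy_seqs V \<rho>" "\<eta> = cauchy_rel V \<rho> `` {y}"
      using a(1,2) unfolding seq_completion_def quotient_def by auto
    then have "lim_of x = lim_of y" using h_class[of x] h_class[of y] a(3) by simp
    then show "\<xi> = \<eta>" using xy class_eq[of x] class_eq[of y] by simp
  qed
next
  fix l assume "l \<in> h ` seq_completion V \<rho>"
  then obtain \<xi> where \<xi>: "\<xi> \<in> seq_completion V \<rho>" "l = h \<xi>" by blast
  obtain x where "x \<in> \<xi>" using ex_rep[OF \<xi>(1)] .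
  then show "l \<in> Y" using h_mem[OF \<xi>(1)] cauchy_limit(1) \<xi>(2) by simp
next
  fix l assume l: "l \<in> Y"
  then have "l \<in> Y.mtopology closure_of (f ` V)" using dense by simp
  then have dense_l: "\<forall>r>0. \<exists>v\<in>V. D l (f v) < r"
    unfolding Y.metric_closure_of by (auto simp: Y.in_mball)
  have ex: "\<exists>v\<in>V. D l (f v) < inverse (Suc n)" for n
    by (rule dense_l[rule_format]) simp
  define x where "x n = (SOME v. v \<in> V \<and> D l (f v) < inverse (Suc n))" for n
  have x: "x n \<in> V \<and> D l (f (x n)) < inverse (Suc n)" for n
    unfolding x_def by (rule someI_ex) (use ex in blast)
  have "(\<lambda>n. D (f (x n)) l) \<longlonglongrightarrow> 0"
    by (rule tendsto_sandwich[OF _ _ tendsto_const LIMSEQ_inverse_real_of_nat])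
      (use x in \<open>auto simp: Y.commute less_imp_le\<close>)
  then have "x \<in> cauchy_seqs V \<rho>" "lim_of x = l"
    using theta_cauchy[of x l] x l by auto
  then show "l \<in> h ` seq_completion V \<rho>"
    using h_class unfolding seq_completion_def by (metis image_eqI quotientI)
qed

lemma h_near:
  assumes "\<xi> \<in> seq_completion V \<rho>" "\<eta> \<in> seq_completion V \<rho>"
  shows "D (h \<xi>) (h \<eta>) < c * e \<Longrightarrow> completion_near \<rho> e \<xi> \<eta>"
    and "completion_near \<rho> e \<xi> \<eta> \<Longrightarrow> D (h \<xi>) (h \<eta>) \<le> C * e"
proof -
  assume D: "D (h \<xi>) (h \<eta>) < c * e"
  obtain x y where xy: "x \<in> \<xi>" "y \<in> \<eta>" using assms ex_rep by metis
  note x = h_mem[OF assms(1) xy(1)] and y = h_mem[OF assms(2) xy(2)]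
  have V: "x n \<in> V" "y n \<in> V" for n using x y by (auto simp: cauchy_seqs_def)
  have "\<forall>\<^sub>F n in sequentially. \<theta> (x n) (y n) < c * e"
    using order_tendstoD(2)[OF dist_limit[OF x(1) y(1)]] D x y by simp
  then have "\<forall>\<^sub>F n in sequentially. \<rho> (x n) (y n) < e"
    by (rule eventually_mono) (use V rho_less in auto)
  then show "completion_near \<rho> e \<xi> \<eta>" unfolding completion_near_def using xy by blast
next
  assume "completion_near \<rho> e \<xi> \<eta>"
  then obtain x y where xy: "x \<in> \<xi>" "y \<in> \<eta>" and ev: "\<forall>\<^sub>F n in sequentially. \<rho> (x n) (y n) < e"
    unfolding completion_near_def by blast
  note x = h_mem[OF assms(1) xy(1)] and y = h_mem[OF assms(2) xy(2)]
  have V: "x n \<in> V" "y n \<in> V" for n using x y by (auto simp: cauchy_seqs_def)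
  have "\<forall>\<^sub>F n in sequentially. \<theta> (x n) (y n) \<le> C * e"
    using ev by (rule eventually_mono) (use V theta_less less_imp_le in blast)
  then show "D (h \<xi>) (h \<eta>) \<le> C * e"
    using tendsto_upperbound[OF dist_limit[OF x(1) y(1)]] x y by simp
qed

lemma homeomorphic_completion:
  "homeomorphic_map (completion_topology V \<rho>) Y.mtopology h"
proof (rule bijective_open_imp_homeomorphic_map)
  have hY: "h \<xi> \<in> Y" if "\<xi> \<in> seq_completion V \<rho>" for \<xi>
    using h_bij that by (auto simp: bij_betw_def)
  show "continuous_map (completion_topology V \<rho>) Y.mtopology h"
    unfolding continuous_map_def openin_completion_topology topspace_completion_topology
  proof (intro conjI allI impI)
    show "h \<in> seq_completion V \<rho> \<rightarrow> topspace Y.mtopology" using hY by auto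
    fix U assume U: "openin Y.mtopology U"
    have "\<exists>\<epsilon>>0. \<forall>\<eta>\<in>seq_completion V \<rho>. completion_near \<rho> \<epsilon> \<xi> \<eta> \<longrightarrow> h \<eta> \<in> U"
      if \<xi>: "\<xi> \<in> seq_completion V \<rho>" "h \<xi> \<in> U" for \<xi>
    proof -
      obtain e where e: "e > 0" "Y.mball (h \<xi>) e \<subseteq> U"
        using U \<xi>(2) unfolding Y.openin_mtopology by blast
      show ?thesis
      proof (intro exI[of _ "e / (2 * C)"] conjI ballI impI)
        show "e / (2 * C) > 0" using e C by simp
        fix \<eta> assume \<eta>: "\<eta> \<in> seq_completion V \<rho>" "completion_near \<rho> (e / (2 * C)) \<xi> \<eta>"
        have "D (h \<xi>) (h \<eta>) \<le> C * (e / (2 * C))"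
          by (rule h_near(2)[OF \<xi>(1) \<eta>])
        also have "\<dots> < e" using e C by simp
        finally show "h \<eta> \<in> U" using e(2) hY \<xi>(1) \<eta>(1) by (auto simp: Y.in_mball)
      qed
    qed
    then show "completion_open V \<rho> {\<xi> \<in> seq_completion V \<rho>. h \<xi> \<in> U}"
      unfolding completion_open_def by auto
  qed
  show "open_map (completion_topology V \<rho>) Y.mtopology h"
    unfolding open_map_def openin_completion_topology Y.openin_mtopology
  proof (intro allI impI conjI)
    fix U assume U: "completion_open V \<rho> U"
    then have UV: "U \<subseteq> seq_completion V \<rho>" unfolding completion_open_def by blast
    then show "h ` U \<subseteq> Y" using hY by auto
    fix l assume "l \<in> h ` U"
    then obtain \<xi> where \<xi>: "\<xi> \<in> U" "l = h \<xi>" by blast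
    obtain e where e: "e > 0" "\<forall>\<eta>\<in>seq_completion V \<rho>. completion_near \<rho> e \<xi> \<eta> \<longrightarrow> \<eta> \<in> U"
      using U \<xi>(1) unfolding completion_open_def by blast
    have "Y.mball l (c * e) \<subseteq> h ` U"
    proof
      fix m assume "m \<in> Y.mball l (c * e)"
      then have m: "m \<in> Y" "D l m < c * e" by (auto simp: Y.in_mball)
      then obtain \<eta> where "\<eta> \<in> seq_completion V \<rho>" "m = h \<eta>"
        using h_bij by (auto simp: bij_betw_def)
      then show "m \<in> h ` U" using h_near(1)[of \<xi> \<eta> e] e \<xi> UV m by auto
    qed
    then show "\<exists>r>0. Y.mball l r \<subseteq> h ` U" using e c by (intro exI[of _ "c * e"]) auto
  qed
  show "h ` topspace (completion_topology V \<rho>) = topspace Y.mtopology"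
    "inj_on h (topspace (completion_topology V \<rho>))"
    using h_bij by (auto simp: bij_betw_def topspace_completion_topology)
qed

lemma homeomorphic_boundary:
  "homeomorphic_map (completion_boundary V \<rho>) (subtopology Y.mtopology (Y - f ` V)) h"
  unfolding completion_boundary_def
proof (rule homeomorphic_map_subtopologies[OF homeomorphic_completion])
  have "h ` (seq_completion V \<rho> - completion_embed V \<rho> ` V) = Y - h ` completion_embed V \<rho> ` V"
    using h_bij h_embed(2) inj_on_image_set_diff[of h "seq_completion V \<rho>"
        "seq_completion V \<rho>" "completion_embed V \<rho> ` V"]
    by (auto simp: bij_betw_def)
  also have "h ` completion_embed V \<rho> ` V = f ` V" using h_embed(1) by force
  finally show "h ` (topspace (completion_topology V \<rho>) \<inter> (seq_completion V \<rho> - completion_embed V \<rho> ` V)) =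
      topspace Y.mtopology \<inter> (Y - f ` V)"
    by (simp add: topspace_completion_topology Int_absorb1)
qed

end

end

theory Submission
  imports Defs
begin

text \<open>
  Both the augmented tree and its quotient are graphs of cells: a vertex of level \<open>n\<close> carries a copy
  of \<open>K\<close> of size comparable to \<open>t ^ n\<close>, where \<open>t\<close> is the least contraction ratio, the cells of each
  level cover \<open>K\<close>, and two distinct vertices of level \<open>n\<close> are horizontal neighbours if and only if their cells
  are at most \<open>\<kappa> * t ^ n\<close> apart.  Everything is proved in the locale \<open>cell_graph\<close>, which captures this,
  and its extension \<open>cell_graph_boundary\<close>; the theorem is an instance for each of the two graphs.

  Bounded components make \<open>K\<close> totally disconnected because the cells of a component of level \<open>n\<close> form
  an open and closed subset of \<open>K\<close>, of diameter \<open>O(t ^ n)\<close> (\<open>bounded_components_imp_totally_disconnected\<close>).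

  For the converse, total disconnectedness of a compact set is expressed by chains: for every
  \<open>e > 0\<close> there is a \<open>d > 0\<close> such that chains of points with steps at most \<open>d\<close> have their ends at
  most \<open>e\<close> apart (\<open>totally_disconnected_imp_chains_within\<close>).  This property passes to unions of \<open>k\<close>
  similar copies of \<open>K\<close> of size about \<open>s\<close>, with constants that depend on \<open>k\<close> only and scale with \<open>s\<close>
  (\<open>chains_within_Union\<close>).  Bounded degree means that a ball of radius \<open>R * t ^ m\<close> meets boundedly
  many cells of level \<open>m\<close> (\<open>bounded_degree_imp_few_cells\<close>).  Hence, for some \<open>d\<close> and all \<open>m\<close>, a chain
  in \<open>K\<close> with steps at most \<open>d * t ^ m\<close> stays in a ball of radius \<open>t ^ m\<close> (\<open>chains_confined\<close>).  A
  horizontal path of level \<open>n\<close> traces a chain with steps \<open>O(t ^ n)\<close>, so it is confined to a ball of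
  radius \<open>O(t ^ n)\<close>, which meets boundedly many cells of level \<open>n\<close>; this bounds its component.

  Finally, the hyperbolic boundary is homeomorphic to \<open>K\<close> (\<open>homeomorphic_boundary\<close>).  The
  distance between points of the cells of \<open>x\<close> and \<open>y\<close> is \<open>O(t ^ g)\<close>, where \<open>g\<close> is the Gromov product
  of \<open>x\<close> and \<open>y\<close> (\<open>dist_le_if_gprod\<close>), and if this distance is at most \<open>\<kappa> * t ^ k\<close> for vertices of
  level at least \<open>k\<close>, then \<open>g \<ge> k - 1/2\<close> (\<open>gprod_ge_if_close\<close>).  So a sequence of vertices whose levels
  tend to infinity is Cauchy for the visual distance if and only if its cells converge to a point
  of \<open>K\<close>, and two such Cauchy sequences are equivalent if and only if the points agree.
\<close>

section \<open>Chains in metric spaces\<close>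

definition chain_linked :: "real \<Rightarrow> 'a::metric_space set \<Rightarrow> ('a \<times> 'a) set" where
  "chain_linked d A = {(p, q). p \<in> A \<and> q \<in> A \<and> dist p q \<le> d}\<^sup>*"

definition chains_within :: "real \<Rightarrow> real \<Rightarrow> 'a::metric_space set \<Rightarrow> bool" where
  "chains_within e d A \<longleftrightarrow> (\<forall>p q. (p, q) \<in> chain_linked d A \<longrightarrow> dist p q \<le> e)"

lemma chains_withinD: "chains_within e d A \<Longrightarrow> (p, q) \<in> chain_linked d A \<Longrightarrow> dist p q \<le> e"
  by (simp add: chains_within_def)

lemma chain_linked_refl: "(p, p) \<in> chain_linked d A"
  by (simp add: chain_linked_def)

lemma chain_linked_step:
  assumes "(p, q) \<in> chain_linked d A" "q \<in> A" "q' \<in> A" "dist q q' \<le> d"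
  shows "(p, q') \<in> chain_linked d A"
  using assms unfolding chain_linked_def by (auto intro: rtrancl_into_rtrancl)

lemma chain_linked_mono: "d \<le> d' \<Longrightarrow> chain_linked d A \<subseteq> chain_linked d' A"
  unfolding chain_linked_def by (rule rtrancl_mono) auto

lemma chain_linked_induct [consumes 1, case_names refl step]:
  assumes "(p, q) \<in> chain_linked d A" and "P p"
    and "\<And>q q'. \<lbrakk>(p, q) \<in> chain_linked d A; P q; q \<in> A; q' \<in> A; dist q q' \<le> d\<rbrakk> \<Longrightarrow> P q'"
  shows "P q"
  using assms(1) unfolding chain_linked_def
  by (induction rule: rtrancl_induct) (use assms(2,3) in \<open>auto simp: chain_linked_def\<close>)

lemma chains_within_mono:
  assumes "chains_within e d A" "e \<le> e'" "d' \<le> d"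
  shows "chains_within e' d' A"
  using assms chain_linked_mono[of d' d A] unfolding chains_within_def by force

lemma chains_within_similar:
  assumes "chains_within e d K" and s: "s > 0" "\<And>p q. dist (f p) (f q) = s * dist p q"
  shows "chains_within (s * e) (s * d) (f ` K)"
  unfolding chains_within_def
proof (intro allI impI)
  fix p q assume pq: "(p, q) \<in> chain_linked (s * d) (f ` K)"
  have e: "e \<ge> 0"
    using chains_withinD[OF assms(1) chain_linked_refl] by simp
  have "p = q \<or> (\<exists>u v. p = f u \<and> q = f v \<and> u \<in> K \<and> v \<in> K \<and> (u, v) \<in> chain_linked d K)"
    using pq
  proof (induction rule: chain_linked_induct)
    case (step q q')
    then obtain w w' where w: "q = f w" "w \<in> K" "q' = f w'" "w' \<in> K" by blast
    have inj: "f a = f b \<Longrightarrow> a = b" for a b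
      using s(2)[of a b] s(1) by simp
    have ww: "dist w w' \<le> d" using step.hyps(4) s w by simp
    from step.IH show ?case
    proof
      assume "p = q"
      then show ?thesis
        using w chain_linked_step[OF chain_linked_refl w(2,4) ww] by blast
    next
      assume "\<exists>u v. p = f u \<and> q = f v \<and> u \<in> K \<and> v \<in> K \<and> (u, v) \<in> chain_linked d K"
      then obtain u where "p = f u" "u \<in> K" "(u, w) \<in> chain_linked d K" using inj w(1) by blast
      then show ?thesis
        using w chain_linked_step[OF _ w(2,4) ww] by blast
    qed
  qed simp
  then show "dist p q \<le> s * e"
    using s e chains_withinD[OF assms(1)] by (auto simp: mult_left_mono)
qed

text \<open>
  This quantifies the fact that the union of two totally disconnected compact sets is totally
  disconnected.  In a \<open>d'\<close>-chain of \<open>A \<union> B\<close>, two successive visits to \<open>A\<close> are separated by a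
  chain of \<open>B\<close>, whose ends are at most \<open>d/3\<close> apart.  As single steps are also at most \<open>d/3\<close>, the
  visits to \<open>A\<close> form a \<open>d\<close>-chain of \<open>A\<close>, and the rest stays close to it.
\<close>

lemma chains_within_Un:
  assumes A: "chains_within e d A" and B: "chains_within (d/3) d' B" and d: "d' \<le> d/3" "0 < d"
  shows "chains_within (e + 2 * d) d' (A \<union> B)"
  unfolding chains_within_def
proof (intro allI impI)
  fix p q assume pq: "(p, q) \<in> chain_linked d' (A \<union> B)"
  let ?tail = "\<lambda>a q. q = a \<or> (\<exists>b\<in>B. dist a b \<le> d' \<and> q \<in> B \<and> (b, q) \<in> chain_linked d' B)"
  \<comment> \<open>\<open>a\<close> and \<open>a'\<close> are the first and the last point of the chain that lie in \<open>A\<close>\<close>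
  let ?inv = "\<lambda>q. (p \<in> B \<and> q \<in> B \<and> (p, q) \<in> chain_linked d' B) \<or>
    (\<exists>a\<in>A. \<exists>a'\<in>A. dist p a \<le> d/3 + d' \<and> (a, a') \<in> chain_linked d A \<and> ?tail a' q)"
  have tail: "dist a q \<le> d' + d/3" if "?tail a q" "d' \<ge> 0" for a q
    using that
  proof (elim disjE bexE conjE)
    fix b assume b: "dist a b \<le> d'" "(b, q) \<in> chain_linked d' B"
    then show ?thesis using chains_withinD[OF B b(2)] dist_triangle[of a q b] by linarith
  qed (use d in auto)
  have e: "e \<ge> 0"
    using chains_withinD[OF A chain_linked_refl] by simp
  show "dist p q \<le> e + 2 * d"
  proof (cases "p = q \<or> d' < 0")
    case True
    have "p = q" if "d' < 0"
      using pq
    proof (induction rule: chain_linked_induct)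
      case (step q q')
      then show ?case using that zero_le_dist[of q q'] by linarith
    qed simp
    then show ?thesis using True e d by auto
  next
    case False
    then have d'0: "d' \<ge> 0" by simp
    have "p = q \<or> p \<in> A \<union> B"
      using pq by (induction rule: chain_linked_induct) auto
    then have pAB: "p \<in> A \<union> B" using False by simp
    have "?inv q"
      using pq
    proof (induction rule: chain_linked_induct)
      case refl
      then show ?case using pAB d d'0 chain_linked_refl by fastforce
    next
      case (step q q')
      from step.IH show ?case
      proof (elim disjE)
        assume h: "p \<in> B \<and> q \<in> B \<and> (p, q) \<in> chain_linked d' B"
        then have pq: "dist p q \<le> d/3" using chains_withinD[OF B] by blast
        show ?thesis
        proof (cases "q' \<in> B")
          case True
          then show ?thesis using h chain_linked_step step.hyps by blast
        next
          case False
          then have "q' \<in> A" using step by blast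
          moreover have "dist p q' \<le> d/3 + d'"
            using pq step.hyps dist_triangle[of p q' q] by linarith
          ultimately show ?thesis using chain_linked_refl by blast
        qed
      next
        assume "\<exists>a\<in>A. \<exists>a'\<in>A. dist p a \<le> d/3 + d' \<and> (a, a') \<in> chain_linked d A \<and> ?tail a' q"
        then obtain a a' where a: "a \<in> A" "a' \<in> A" "dist p a \<le> d/3 + d'"
          "(a, a') \<in> chain_linked d A" and t: "?tail a' q" by blast
        show ?thesis
        proof (cases "q' \<in> A")
          case True
          have "dist a' q' \<le> d"
            using tail[OF t d'0] step.hyps d dist_triangle[of a' q' q] by linarith
          then have "(a, q') \<in> chain_linked d A"
            using chain_linked_step[OF a(4) a(2) True] by blast
          then show ?thesis using a True by blast
        next
          case False
          then have q': "q' \<in> B" using step by blast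
          from t have "?tail a' q'"
          proof (elim disjE)
            assume "q = a'"
            then show ?thesis using q' step.hyps chain_linked_refl by blast
          next
            assume "\<exists>b\<in>B. dist a' b \<le> d' \<and> q \<in> B \<and> (b, q) \<in> chain_linked d' B"
            then show ?thesis using q' step.hyps chain_linked_step by blast
          qed
          then show ?thesis using a by blast
        qed
      qed
    qed
    then show ?thesis
    proof (elim disjE)
      assume "p \<in> B \<and> q \<in> B \<and> (p, q) \<in> chain_linked d' B"
      then have "dist p q \<le> d/3" using chains_withinD[OF B] by blast
      then show ?thesis using e d by linarith
    next
      assume "\<exists>a\<in>A. \<exists>a'\<in>A. dist p a \<le> d/3 + d' \<and> (a, a') \<in> chain_linked d A \<and> ?tail a' q"
      then obtain a a' where a: "dist p a \<le> d/3 + d'" "(a, a') \<in> chain_linked d A"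
        and t: "?tail a' q" by blast
      have "dist p q \<le> dist p a + dist a a' + dist a' q"
        using dist_triangle[of p q a] dist_triangle[of a q a'] by linarith
      then show ?thesis
        using a(1) chains_withinD[OF A a(2)] tail[OF t d'0] d by linarith
    qed
  qed
qed

text \<open>
  The bound depends on the number of sets only, and it scales: this uniformity is what a
  compactness argument for the rescaled pieces of a self-similar set would otherwise provide.
\<close>

lemma chains_within_Union:
  fixes \<A> :: "real \<Rightarrow> 'a::metric_space set set"
  assumes \<A>: "\<And>e. e > 0 \<Longrightarrow> \<exists>d>0. \<forall>s>0. \<forall>A\<in>\<A> s. chains_within (e * s) (d * s) A"
    and "e > 0"
  shows "\<exists>d>0. \<forall>s>0. \<forall>F\<subseteq>\<A> s. finite F \<and> card F \<le> k \<longrightarrow> chains_within (e * s) (d * s) (\<Union>F)"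
  using \<open>e > 0\<close>
proof (induction k arbitrary: e)
  case 0
  have "chains_within (e * s) (1 * s) ({} :: 'a set)" if "s > 0" for s
    unfolding chains_within_def
  proof (intro allI impI)
    fix p q :: 'a assume "(p, q) \<in> chain_linked (1 * s) {}"
    then show "dist p q \<le> e * s"
      by (induction rule: chain_linked_induct) (use 0 that in auto)
  qed
  then show ?case by (intro exI[of _ 1]) auto
next
  case (Suc k)
  obtain d1 where d1: "d1 > 0" "\<And>s A. s > 0 \<Longrightarrow> A \<in> \<A> s \<Longrightarrow> chains_within (e/2 * s) (d1 * s) A"
    using \<A>[of "e/2"] Suc.prems by auto
  define d where "d = min d1 (e/4)"
  have d: "d > 0" "d \<le> d1" "d \<le> e/4" using d1 Suc.prems by (auto simp: d_def)
  obtain d2 where d2: "d2 > 0"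
    "\<And>s F. s > 0 \<Longrightarrow> F \<subseteq> \<A> s \<Longrightarrow> finite F \<and> card F \<le> k \<Longrightarrow> chains_within (d/3 * s) (d2 * s) (\<Union>F)"
    using Suc.IH[of "d/3"] d by auto
  define d' where "d' = min d2 (d/3)"
  have d': "d' > 0" "d' \<le> d2" "d' \<le> d/3" using d2 d by (auto simp: d'_def)
  have "chains_within (e * s) (d' * s) (\<Union>F)"
    if s: "s > 0" and F: "F \<subseteq> \<A> s" "finite F" "card F \<le> Suc k" for s F
  proof (cases "F = {}")
    case True
    then show ?thesis
      using chains_within_mono[OF d2(2)[OF s, of "{}"], of "e * s" "d' * s"] d d' s by auto
  next
    case False
    then obtain A where AF: "A \<in> F" by blast
    have cF: "card (F - {A}) \<le> k" using F AF by simp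
    have "chains_within (e/2 * s + 2 * (d * s)) (d' * s) (A \<union> \<Union>(F - {A}))"
    proof (rule chains_within_Un)
      show "chains_within (e/2 * s) (d * s) A"
        using chains_within_mono[OF d1(2)[OF s, of A], of "e/2 * s" "d * s"] AF F d s by auto
      show "chains_within (d * s / 3) (d' * s) (\<Union>(F - {A}))"
        using chains_within_mono[OF d2(2)[OF s, of "F - {A}"], of "d * s / 3" "d' * s"] cF F d' s
        by auto
      show "d' * s \<le> d * s / 3" using d' s by (simp add: mult_right_mono[of d' "d/3", simplified])
      show "0 < d * s" using d s by simp
    qed
    moreover have "A \<union> \<Union>(F - {A}) = \<Union>F" using AF by blast
    moreover have "e/2 * s + 2 * (d * s) \<le> e * s"
      using mult_right_mono[OF d(3), of s] s by (simp add: field_simps)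
    ultimately show ?thesis using chains_within_mono by fastforce
  qed
  then show ?case using d' by blast
qed

text \<open>
  In a compact totally disconnected set every point has a small neighbourhood that is open and
  closed in the set (Sura-Bura).  By compactness finitely many of these suffice, and a chain
  whose steps are shorter than all their distances to their complements cannot leave any of them.
\<close>

lemma totally_disconnected_imp_chains_within:
  fixes K :: "'a::euclidean_space set"
  assumes "compact K" and K: "totally_disconnected_space (top_of_set K)" and "e > 0"
  shows "\<exists>d>0. chains_within e d K"
proof -
  have "\<exists>W. openin (top_of_set K) W \<and> compact W \<and> p \<in> W \<and> W \<subseteq> ball p (e/2)" if "p \<in> K" for p
  proof -
    have "connected_component_set K p = {p}"
    proof
      have "connectedin (top_of_set K) (connected_component_set K p)"
        by (simp add: connectedin_subtopology connected_component_subset)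
      then show "connected_component_set K p \<subseteq> {p}"
        using K that connected_component_of_maximal[of "top_of_set K" "connected_component_set K p" p]
        unfolding totally_disconnected_space_def by auto
    qed (use that in auto)
    then have "{p} \<in> components K" using that by (metis componentsI)
    moreover have "locally compact K"
      using \<open>compact K\<close> by (simp add: closed_imp_locally_compact compact_imp_closed)
    ultimately obtain W where "openin (top_of_set K) W" "compact W" "{p} \<subseteq> W" "W \<subseteq> ball p (e/2)"
      using Sura_Bura_clopen_subset[of K "{p}" "ball p (e/2)"] \<open>e > 0\<close> by auto
    then show ?thesis by auto
  qed
  then obtain W where W: "\<And>p. p \<in> K \<Longrightarrow>
      openin (top_of_set K) (W p) \<and> compact (W p) \<and> p \<in> W p \<and> W p \<subseteq> ball p (e/2)"
    by metis
  then have "\<forall>U\<in>W ` K. openin (top_of_set K) U" "K \<subseteq> \<Union>(W ` K)" by auto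
  then obtain \<F> where "finite \<F>" "\<F> \<subseteq> W ` K" "K \<subseteq> \<Union>\<F>"
    using \<open>compact K\<close> unfolding compact_eq_openin_cover by meson
  then obtain P where P: "finite P" "P \<subseteq> K" "K \<subseteq> (\<Union>p\<in>P. W p)"
    by (metis finite_subset_image)
  have "\<exists>d>0. \<forall>u\<in>W p. \<forall>v\<in>K. dist u v \<le> d \<longrightarrow> v \<in> W p" if p: "p \<in> K" for p
  proof -
    obtain U where U: "open U" "W p = K \<inter> U"
      using W[OF p] by (auto simp: openin_open)
    have "closed (K - W p)"
      using \<open>compact K\<close> U by (simp add: Diff_Int compact_diff compact_imp_closed)
    then obtain d where d: "d > 0" "\<forall>u\<in>W p. \<forall>v\<in>K - W p. d \<le> dist u v"
      using separate_compact_closed[of "W p" "K - W p"] W[OF p] by blast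
    show ?thesis
      by (intro exI[of _ "d/2"]) (use d in force)
  qed
  then obtain \<delta> where \<delta>: "\<And>p. p \<in> K \<Longrightarrow> \<delta> p > 0"
    "\<And>p u v. p \<in> K \<Longrightarrow> u \<in> W p \<Longrightarrow> v \<in> K \<Longrightarrow> dist u v \<le> \<delta> p \<Longrightarrow> v \<in> W p"
    by metis
  define d where "d = Min (insert 1 (\<delta> ` P))"
  have d: "d > 0" "\<And>p. p \<in> P \<Longrightarrow> d \<le> \<delta> p"
    using P \<delta>(1) by (auto simp: d_def)
  have "chains_within e d K"
    unfolding chains_within_def
  proof (intro allI impI)
    fix u v assume uv: "(u, v) \<in> chain_linked d K"
    show "dist u v \<le> e"
    proof (cases "u \<in> K")
      case True
      then obtain p where p: "p \<in> P" "u \<in> W p" using P by blast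
      from uv have "v \<in> W p"
      proof (induction rule: chain_linked_induct)
        case (step q q')
        then show ?case using \<delta>(2)[of p q q'] p P d(2)[of p] by auto
      qed (use p in simp)
      then have "u \<in> ball p (e/2)" "v \<in> ball p (e/2)" using W[of p] p P by blast+
      then have "dist p u < e/2" "dist p v < e/2" by (simp_all only: mem_ball)
      then show ?thesis using dist_triangle3[of u v p] by linarith
    next
      case False
      from uv have "v = u"
        unfolding chain_linked_def using False by (auto elim: converse_rtranclE)
      then show ?thesis using \<open>e > 0\<close> by simp
    qed
  qed
  then show ?thesis using d by blast
qed

section \<open>Graphs of cells of a self-similar set\<close>

text \<open>
  The common setting for the augmented tree and its quotient: a vertex \<open>x\<close> of level \<open>n\<close> carries a
  cell \<open>A x\<close>, a copy of \<open>K\<close> of size comparable to \<open>t ^ n\<close>.  For the quotient, the cell of a class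
  is the common cell of its members.
\<close>

locale cell_graph =
  fixes L :: "nat \<Rightarrow> 'v set" and A :: "'v \<Rightarrow> 'a::euclidean_space set"
    and Ev Eh :: "('v \<times> 'v) set" and K :: "'a set" and \<kappa> t :: real and root :: 'v
  assumes K: "compact K" "K \<noteq> {}"
    and t: "0 < t" "t < 1"
    and \<kappa>: "\<kappa> > 0"
    and level_0: "L 0 = {root}"
    and level_unique: "x \<in> L m \<Longrightarrow> x \<in> L n \<Longrightarrow> m = n"
    and cell_similar: "x \<in> L n \<Longrightarrow>
      \<exists>f s. A x = f ` K \<and> t ^ Suc n \<le> s \<and> s \<le> t ^ n \<and> (\<forall>p q. dist (f p) (f q) = s * dist p q)"
    and cells_cover: "K = (\<Union>x\<in>L n. A x)"
    and Eh_iff: "(x, y) \<in> Eh \<longleftrightarrow>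
      x \<noteq> y \<and> (\<exists>n. x \<in> L n \<and> y \<in> L n \<and> setdist (A x) (A y) \<le> \<kappa> * t ^ n)"
    and Ev_sym: "sym Ev"
    and Ev_levels: "(x, y) \<in> Ev \<Longrightarrow>
      \<exists>n. x \<in> L n \<and> y \<in> L (Suc n) \<and> A y \<subseteq> A x \<or> y \<in> L n \<and> x \<in> L (Suc n) \<and> A x \<subseteq> A y"
    and parent: "y \<in> L (Suc n) \<Longrightarrow> \<exists>x\<in>L n. (x, y) \<in> Ev"
begin

abbreviation V :: "'v set" where "V \<equiv> \<Union>n. L n"

abbreviation E :: "('v \<times> 'v) set" where "E \<equiv> Ev \<union> Eh"

abbreviation diam :: real where "diam \<equiv> diameter K"

lemma diam_nonneg: "diam \<ge> 0"
  using K compact_imp_bounded diameter_ge_0 by blast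

lemma K_dist: "p \<in> K \<Longrightarrow> q \<in> K \<Longrightarrow> dist p q \<le> diam"
  using K compact_imp_bounded diameter_bounded_bound by blast

lemma cell_subset: "x \<in> L n \<Longrightarrow> A x \<subseteq> K"
  using cells_cover[of n] by blast

lemma cell_nonempty: "x \<in> L n \<Longrightarrow> A x \<noteq> {}"
  using cell_similar[of x n] K by auto

lemma cell_compact:
  assumes "x \<in> L n" shows "compact (A x)"
proof -
  obtain f s where f: "A x = f ` K" "t ^ Suc n \<le> s" "\<And>p q. dist (f p) (f q) = s * dist p q"
    using cell_similar[OF assms] by blast
  have "s \<ge> 0" using f(2) t by (smt (verit) zero_less_power)
  then have "s-lipschitz_on K f"
    by (intro lipschitz_onI) (simp_all add: f(3))
  then show ?thesis
    using f(1) K compact_continuous_image lipschitz_on_continuous_on by metis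
qed

lemma cell_dist:
  assumes "x \<in> L n" "p \<in> A x" "q \<in> A x"
  shows "dist p q \<le> diam * t ^ n"
proof -
  obtain f s where f: "A x = f ` K" "s \<le> t ^ n" "\<And>p q. dist (f p) (f q) = s * dist p q"
    using cell_similar[OF assms(1)] by blast
  obtain u v where uv: "u \<in> K" "p = f u" "v \<in> K" "q = f v" using assms f by auto
  have "dist p q = s * dist u v" using f uv by simp
  also have "\<dots> \<le> t ^ n * diam"
    using f(2) K_dist[OF uv(1,3)] t by (intro mult_mono) auto
  finally show ?thesis by (simp add: mult.commute)
qed

lemma ex_cell: "p \<in> K \<Longrightarrow> \<exists>x\<in>L n. p \<in> A x"
  using cells_cover[of n] by blast

lemma Eh_sym: "(x, y) \<in> Eh \<Longrightarrow> (y, x) \<in> Eh"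
  unfolding Eh_iff by (auto simp: setdist_sym)

lemma Eh_level: "(x, y) \<in> Eh \<Longrightarrow> x \<in> L n \<longleftrightarrow> y \<in> L n"
  unfolding Eh_iff by (auto dest: level_unique)

lemma Eh_rtrancl_level: "(x, y) \<in> Eh\<^sup>* \<Longrightarrow> x \<in> L n \<longleftrightarrow> y \<in> L n"
  by (induction rule: rtrancl_induct) (blast dest: Eh_level)+

lemma Eh_if_close:
  assumes "x \<in> L n" "y \<in> L n" "x \<noteq> y" "p \<in> A x" "q \<in> A y" "dist p q \<le> \<kappa> * t ^ n"
  shows "(x, y) \<in> Eh"
  using assms setdist_le_dist[of p "A x" q "A y"] unfolding Eh_iff by force

definition stride :: real where "stride = 2 * diam + \<kappa>"

lemma stride: "stride > 0" "diam \<le> stride"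
  using \<kappa> diam_nonneg by (auto simp: stride_def)

lemma Eh_dist:
  assumes "(x, y) \<in> Eh" "x \<in> L n" "p \<in> A x" "q \<in> A y"
  shows "dist p q \<le> stride * t ^ n"
proof -
  have y: "y \<in> L n" using assms Eh_level by blast
  obtain m where "x \<in> L m" "setdist (A x) (A y) \<le> \<kappa> * t ^ m"
    using assms(1) unfolding Eh_iff by blast
  then have sd: "setdist (A x) (A y) \<le> \<kappa> * t ^ n" using level_unique assms(2) by blast
  obtain u v where uv: "u \<in> A x" "v \<in> A y" "dist u v = setdist (A x) (A y)"
    using setdist_compact_closed[of "A x" "A y"] cell_compact cell_nonempty assms(2) y
      compact_imp_closed by metis
  have "dist p q \<le> dist p u + dist u v + dist v q"
    using dist_triangle[of p q u] dist_triangle[of u q v] by linarith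
  also have "\<dots> \<le> diam * t ^ n + \<kappa> * t ^ n + diam * t ^ n"
    using cell_dist assms y uv sd by (intro add_mono) auto
  finally show ?thesis by (simp add: stride_def algebra_simps)
qed

end

section \<open>Total disconnectedness and horizontal components\<close>

context cell_graph begin

lemma horizontal_component_iff:
  "horizontal_component L Eh T \<longleftrightarrow> (\<exists>n. \<exists>x\<in>L n. T = Eh\<^sup>* `` {x})"
proof -
  have conn: "edge_connected Eh (Eh\<^sup>* `` {x})" for x
  proof -
    let ?T = "Eh\<^sup>* `` {x}"
    have from_x: "(x, y) \<in> (Eh \<inter> ?T \<times> ?T)\<^sup>*" if "(x, y) \<in> Eh\<^sup>*" for y
      using that
    proof (induction rule: rtrancl_induct)
      case (step y z)
      then have "(x, z) \<in> Eh\<^sup>*" by (simp only: rtrancl_into_rtrancl)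
      then have "(y, z) \<in> Eh \<inter> ?T \<times> ?T" using step by simp
      then show ?case by (rule rtrancl_into_rtrancl[OF step.IH])
    qed simp
    have "sym ((Eh \<inter> ?T \<times> ?T)\<^sup>*)"
      by (intro sym_rtrancl) (auto simp: sym_def Eh_sym)
    then have "(y, z) \<in> (Eh \<inter> ?T \<times> ?T)\<^sup>*" if "y \<in> ?T" "z \<in> ?T" for y z
      using rtrancl_trans[OF symD[of _ x y] from_x[of z]] from_x[of y] that
      by (simp only: Image_singleton_iff)
    then show ?thesis unfolding edge_connected_def by blast
  qed
  have sub: "T \<subseteq> Eh\<^sup>* `` {x}" if "edge_connected Eh T" "x \<in> T" for T x
  proof
    fix y assume "y \<in> T"
    then have "(x, y) \<in> (Eh \<inter> T \<times> T)\<^sup>*" using that unfolding edge_connected_def by simp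
    then show "y \<in> Eh\<^sup>* `` {x}" using rtrancl_mono[of "Eh \<inter> T \<times> T" Eh] by auto
  qed
  have lev: "Eh\<^sup>* `` {x} \<subseteq> L n" if "x \<in> L n" for x n
    using Eh_rtrancl_level that by blast
  show ?thesis
  proof
    assume "horizontal_component L Eh T"
    then obtain n where n: "T \<subseteq> L n" "edge_connected Eh T"
      "\<And>T'. T \<subseteq> T' \<and> T' \<subseteq> L n \<and> edge_connected Eh T' \<Longrightarrow> T' = T"
      unfolding horizontal_component_def by blast
    then obtain x where x: "x \<in> T" unfolding edge_connected_def by blast
    then have "x \<in> L n" using n by blast
    then have "Eh\<^sup>* `` {x} = T"
      using n(3)[of "Eh\<^sup>* `` {x}"] sub[OF n(2) x] conn[of x] lev[of x n] by simp
    then show "\<exists>n. \<exists>x\<in>L n. T = Eh\<^sup>* `` {x}" using \<open>x \<in> L n\<close> by blast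
  next
    assume "\<exists>n. \<exists>x\<in>L n. T = Eh\<^sup>* `` {x}"
    then obtain n x where x: "x \<in> L n" "T = Eh\<^sup>* `` {x}" by blast
    have "x \<in> T" by (simp add: x)
    then have "T' = T" if "T \<subseteq> T'" "edge_connected Eh T'" for T'
      using that sub[of T' x] unfolding x(2) by (meson subset_antisym subset_iff)
    then show "horizontal_component L Eh T"
      unfolding horizontal_component_def using x(2) conn[of x] lev[OF x(1)]
      by (intro exI[of _ n]) simp
  qed
qed

text \<open>
  Two points of a component of \<open>M\<close> vertices are joined by at most \<open>M\<close>-squared edges, so the union
  of its cells has diameter \<open>O(t ^ n)\<close>.  That union is open and closed in \<open>K\<close>, because
  different components are more than \<open>\<kappa> * t ^ n\<close> apart.
\<close>

lemma bounded_components_imp_totally_disconnected: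
  assumes "bounded_horizontal_components L Eh"
  shows "totally_disconnected_space (top_of_set K)"
  unfolding totally_disconnected_space_def
proof
  fix p assume "p \<in> topspace (top_of_set K)"
  then have p: "p \<in> K" by simp
  obtain M where M: "\<And>T. horizontal_component L Eh T \<Longrightarrow> finite T \<and> card T \<le> M"
    using assms unfolding bounded_horizontal_components_def by blast
  let ?C = "connected_component_of_set (top_of_set K) p"
  have "q = p" if q: "q \<in> ?C" for q
  proof -
    have "dist p q \<le> (real (M * M) * stride + diam) * t ^ n" for n
    proof -
      obtain x where x: "x \<in> L n" "p \<in> A x" using ex_cell[OF p] by blast
      define T where "T = Eh\<^sup>* `` {x}"
      have T: "finite T" "card T \<le> M" "T \<subseteq> L n"
        using M[of T] x Eh_rtrancl_level[of x _ n]
        unfolding T_def horizontal_component_iff by blast+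
      let ?W = "\<Union>y\<in>T. A y"
      have WK: "?W \<subseteq> K" using T(3) cell_subset by blast
      have near: "v \<in> ?W" if uv: "u \<in> ?W" "v \<in> K" "dist u v < \<kappa> * t ^ n" for u v
      proof -
        obtain y where y: "y \<in> T" "u \<in> A y" using uv by blast
        obtain z where z: "z \<in> L n" "v \<in> A z" using ex_cell[OF uv(2)] by blast
        have "y = z \<or> (y, z) \<in> Eh"
          using Eh_if_close[of y n z u v] y z T(3) uv by auto
        then have "z \<in> T" using y(1) unfolding T_def by (auto intro: rtrancl_into_rtrancl)
        then show ?thesis using z by blast
      qed
      have kt: "\<kappa> * t ^ n > 0" using \<kappa> t by simp
      have "openin (top_of_set K) ?W"
        unfolding openin_euclidean_subtopology_iff
      proof (intro conjI ballI exI[of _ "\<kappa> * t ^ n"] allI impI)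
        fix u v assume "u \<in> ?W" "v \<in> K" "dist v u < \<kappa> * t ^ n"
        then show "v \<in> ?W" using near[of u v] by (simp only: dist_commute)
      qed (use WK kt in auto)
      moreover have "openin (top_of_set K) (K - ?W)"
        unfolding openin_euclidean_subtopology_iff
      proof (intro conjI ballI exI[of _ "\<kappa> * t ^ n"] allI impI)
        fix u v assume u: "u \<in> K - ?W" and v: "v \<in> K" "dist v u < \<kappa> * t ^ n"
        have "v \<notin> ?W" using near[of v u] u v(2) by (simp only: Diff_iff not_False_eq_True) blast
        then show "v \<in> K - ?W" using v(1) by simp
      qed (use kt in auto)
      then have "closedin (top_of_set K) ?W" using WK by (simp add: closedin_def)
      moreover have "connectedin (top_of_set K) ?C"
        by (rule connectedin_connected_component_of)
      moreover have "p \<in> ?C" using p by (simp add: connected_component_of_refl)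
      moreover have "p \<in> ?W" using x unfolding T_def by blast
      ultimately have "?C \<subseteq> ?W"
        using connectedin_clopen_cases[of "top_of_set K" ?C ?W] unfolding disjnt_iff by blast
      then obtain y where y: "y \<in> T" "q \<in> A y" using q by blast
      let ?R = "Eh \<inter> T \<times> T"
      have cR: "finite ?R" "card ?R \<le> M * M"
      proof -
        show "finite ?R" using T by simp
        have "card ?R \<le> card (T \<times> T)" using T by (intro card_mono) auto
        also have "\<dots> \<le> M * M" using T(2) by (simp add: card_cartesian_product mult_mono)
        finally show "card ?R \<le> M * M" .
      qed
      have "edge_connected Eh T"
        using x horizontal_component_iff[of T] unfolding T_def horizontal_component_def by blast
      moreover have "x \<in> T" by (simp add: T_def)
      ultimately have "(x, y) \<in> ?R\<^sup>*" using y unfolding edge_connected_def by blast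
      then obtain k where k: "k \<le> M * M" "(x, y) \<in> ?R ^^ k"
        using cR(2) unfolding rtrancl_finite_eq_relpow[OF cR(1)] by (auto intro: that order_trans)
      have "\<forall>y q. (x, y) \<in> ?R ^^ k \<longrightarrow> q \<in> A y \<longrightarrow> dist p q \<le> (real k * stride + diam) * t ^ n" for k
      proof (induction k)
        case 0
        then show ?case using cell_dist x by auto
      next
        case (Suc k)
        show ?case
        proof (intro allI impI)
          fix y q assume y: "(x, y) \<in> ?R ^^ Suc k" "q \<in> A y"
          then obtain z where z: "(x, z) \<in> ?R ^^ k" "(z, y) \<in> Eh" "z \<in> T" by auto
          obtain u where u: "u \<in> A z" using cell_nonempty z T by blast
          have "dist p q \<le> dist p u + dist u q" by (rule dist_triangle)
          also have "\<dots> \<le> (real k * stride + diam) * t ^ n + stride * t ^ n"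
            using Suc.IH z u y T Eh_dist[of z y n u q] by (intro add_mono) auto
          finally show "dist p q \<le> (real (Suc k) * stride + diam) * t ^ n"
            by (simp add: algebra_simps)
        qed
      qed
      then have "dist p q \<le> (real k * stride + diam) * t ^ n" using k y by blast
      also have "\<dots> \<le> (real (M * M) * stride + diam) * t ^ n"
      proof -
        have "real k \<le> real (M * M)" using k(1) by (simp only: of_nat_le_iff)
        then show ?thesis using t stride by (intro mult_right_mono add_right_mono) auto
      qed
      finally show ?thesis .
    qed
    moreover have "(\<lambda>n. (real (M * M) * stride + diam) * t ^ n) \<longlonglongrightarrow> 0"
      using t by (intro tendsto_mult_right_zero LIMSEQ_power_zero) auto
    ultimately have "dist p q \<le> 0" by (intro LIMSEQ_le_const) auto
    then show "q = p" by simp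
  qed
  moreover have "p \<in> ?C" using p by (simp add: connected_component_of_refl)
  ultimately show "?C = {p}" by blast
qed

text \<open>
  Bounded degree is a statement about balls of one radius, \<open>\<kappa> * t ^ n / 2\<close>: cells of level \<open>n\<close>
  that meet a common such ball are pairwise adjacent.  A ball of radius \<open>R * t ^ n\<close> is covered by
  a number of those that depends on \<open>R\<close> only.
\<close>

lemma bounded_degree_imp_few_cells:
  assumes "bounded_degree V E"
  shows "\<exists>k. \<forall>n p. finite {y \<in> L n. A y \<inter> cball p (R * t ^ n) \<noteq> {}} \<and>
    card {y \<in> L n. A y \<inter> cball p (R * t ^ n) \<noteq> {}} \<le> k"
proof -
  obtain M where M: "\<And>x. x \<in> V \<Longrightarrow> finite {y. (x, y) \<in> E} \<and> card {y. (x, y) \<in> E} \<le> M"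
    using assms unfolding bounded_degree_def by blast
  have small: "finite {y \<in> L n. A y \<inter> cball q (\<kappa>/2 * t ^ n) \<noteq> {}} \<and>
      card {y \<in> L n. A y \<inter> cball q (\<kappa>/2 * t ^ n) \<noteq> {}} \<le> Suc M" (is "finite ?F \<and> _") for n q
  proof (cases "?F = {}")
    case True
    then show ?thesis by (simp only: finite.emptyI card.empty le0 simp_thms)
  next
    case False
    then obtain y u where y: "y \<in> L n" "u \<in> A y" "dist q u \<le> \<kappa>/2 * t ^ n" by auto
    let ?N = "{z. (y, z) \<in> E}"
    have N: "finite ?N" "card ?N \<le> M" using M[of y] y by auto
    have "?F \<subseteq> insert y ?N"
    proof
      fix z assume "z \<in> ?F"
      then obtain v where v: "z \<in> L n" "v \<in> A z" "dist q v \<le> \<kappa>/2 * t ^ n" by auto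
      have "dist u v \<le> \<kappa> * t ^ n" using y v dist_triangle3[of u v q] by linarith
      then show "z \<in> insert y ?N" using Eh_if_close[of y n z u v] y v by auto
    qed
    moreover have "card (insert y ?N) \<le> Suc M" using N card_insert_le_m1 by (simp add: card_insert_if)
    ultimately show ?thesis using N
      by (meson card_mono finite_insert finite_subset le_trans)
  qed
  have "\<exists>Q. finite Q \<and> cball (0::'a) R \<subseteq> (\<Union>q\<in>Q. ball q (\<kappa>/2))"
    using compact_cball[of 0 R] unfolding compact_eq_totally_bounded
    by (elim conjE allE[of _ "\<kappa>/2"]) (use \<kappa> in simp)
  then obtain Q where Q: "finite Q" "cball (0::'a) R \<subseteq> (\<Union>q\<in>Q. ball q (\<kappa>/2))" by blast
  have "finite {y \<in> L n. A y \<inter> cball p (R * t ^ n) \<noteq> {}} \<and>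
    card {y \<in> L n. A y \<inter> cball p (R * t ^ n) \<noteq> {}} \<le> card Q * Suc M" (is "finite ?G \<and> _") for n p
  proof -
    let ?F = "\<lambda>q. {y \<in> L n. A y \<inter> cball (p + t ^ n *\<^sub>R q) (\<kappa>/2 * t ^ n) \<noteq> {}}"
    have tn: "t ^ n > 0" using t by simp
    have "?G \<subseteq> (\<Union>q\<in>Q. ?F q)"
    proof
      fix y assume "y \<in> ?G"
      then obtain u where u: "y \<in> L n" "u \<in> A y" "dist p u \<le> R * t ^ n" by auto
      define w where "w = (1 / t ^ n) *\<^sub>R (u - p)"
      have "norm w = norm (u - p) / t ^ n" unfolding w_def using tn by (simp only: norm_scaleR) simp
      then have "norm w \<le> R"
        using u(3) tn by (simp add: dist_norm norm_minus_commute field_simps)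
      then obtain q where q: "q \<in> Q" "dist q w < \<kappa>/2" using Q(2) by (force simp: dist_norm)
      have "u = p + t ^ n *\<^sub>R w" using t by (simp add: w_def)
      then have "dist (p + t ^ n *\<^sub>R q) u = dist (p + t ^ n *\<^sub>R q) (p + t ^ n *\<^sub>R w)"
        by (rule arg_cong)
      also have "\<dots> = norm (t ^ n *\<^sub>R (q - w))"
        by (simp only: dist_norm add_diff_cancel_left scaleR_diff_right)
      also have "\<dots> = t ^ n * dist q w"
        using tn by (simp only: norm_scaleR dist_norm abs_of_pos)
      finally have "dist (p + t ^ n *\<^sub>R q) u \<le> \<kappa>/2 * t ^ n"
        using q(2) tn by (simp add: mult.commute)
      then show "y \<in> (\<Union>q\<in>Q. ?F q)" using u q by (auto intro!: bexI[of _ q])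
    qed
    moreover have fin: "finite (\<Union>q\<in>Q. ?F q)" using Q(1) small by blast
    moreover have "card (\<Union>q\<in>Q. ?F q) \<le> card Q * Suc M"
    proof -
      have "card (\<Union>q\<in>Q. ?F q) \<le> (\<Sum>q\<in>Q. card (?F q))"
        using Q(1) by (rule card_UN_le)
      also have "\<dots> \<le> (\<Sum>q\<in>Q. Suc M)" using small by (intro sum_mono) blast
      finally show ?thesis by simp
    qed
    ultimately show ?thesis by (meson card_mono finite_subset le_trans)
  qed
  then show ?thesis by blast
qed

text \<open>
  By self-similarity, finitely many cells of level \<open>m\<close> satisfy a chain bound that is uniform after
  rescaling by \<open>t ^ m\<close>.  Since only boundedly many of them meet a ball of radius \<open>t ^ m\<close>, this
  gives a chain bound for \<open>K\<close> itself at every scale: a chain of steps \<open>d * t ^ m\<close> cannot reach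
  the boundary of that ball.
\<close>

lemma chains_confined:
  assumes "bounded_degree V E" and td: "totally_disconnected_space (top_of_set K)"
  shows "\<exists>d>0. \<forall>m p q. p \<in> K \<longrightarrow> (p, q) \<in> chain_linked (d * t ^ m) K \<longrightarrow> dist p q \<le> t ^ m"
proof -
  define \<A> where "\<A> s = {A x |x n. x \<in> L n \<and> s = t ^ n}" for s
  have cells: "\<exists>d>0. \<forall>s>0. \<forall>B\<in>\<A> s. chains_within (e * s) (d * s) B" if e: "e > 0" for e
  proof -
    obtain d where d: "d > 0" "chains_within e d K"
      using totally_disconnected_imp_chains_within[OF K(1) td e] by blast
    have "chains_within (e * t ^ n) ((d * t) * t ^ n) (A x)" if x: "x \<in> L n" for x n
    proof -
      obtain f s where f: "A x = f ` K" "t ^ Suc n \<le> s" "s \<le> t ^ n"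
        "\<And>p q. dist (f p) (f q) = s * dist p q"
        using cell_similar[OF x] by blast
      have s: "s > 0" using f(2) t by (smt (verit) zero_less_power)
      have "chains_within (s * e) (s * d) (A x)"
        unfolding f(1) using d(2) s f(4) by (rule chains_within_similar)
      then show ?thesis
      proof (rule chains_within_mono)
        show "s * e \<le> e * t ^ n" using f(3) e by (simp add: mult.commute)
        show "(d * t) * t ^ n \<le> s * d" using mult_right_mono[OF f(2), of d] d by (simp add: mult_ac)
      qed
    qed
    then have "\<forall>s>0. \<forall>B\<in>\<A> s. chains_within (e * s) ((d * t) * s) B"
      unfolding \<A>_def by blast
    then show ?thesis using d t by (intro exI[of _ "d * t"]) auto
  qed
  obtain k where k: "\<And>n p. finite {y \<in> L n. A y \<inter> cball p (1 * t ^ n) \<noteq> {}} \<and>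
      card {y \<in> L n. A y \<inter> cball p (1 * t ^ n) \<noteq> {}} \<le> k"
    using bounded_degree_imp_few_cells[OF assms(1)] by blast
  obtain d0 where d0: "d0 > 0" "\<And>s F. s > 0 \<Longrightarrow> F \<subseteq> \<A> s \<Longrightarrow> finite F \<and> card F \<le> k \<Longrightarrow>
      chains_within (1/2 * s) (d0 * s) (\<Union>F)"
    using chains_within_Union[OF cells, where e = "1/2" and k = k] by auto
  define d where "d = min d0 (1/2)"
  have d: "d > 0" "d \<le> d0" "d \<le> 1/2" using d0 by (auto simp: d_def)
  have "dist p q \<le> t ^ m" if p: "p \<in> K" and pq: "(p, q) \<in> chain_linked (d * t ^ m) K" for m p q
  proof -
    have tm: "t ^ m > 0" using t by simp
    define F where "F = {y \<in> L m. A y \<inter> cball p (1 * t ^ m) \<noteq> {}}"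
    define W where "W = (\<Union>y\<in>F. A y)"
    have "chains_within (1/2 * t ^ m) (d0 * t ^ m) W"
      unfolding W_def
    proof (rule d0(2)[OF tm])
      show "A ` F \<subseteq> \<A> (t ^ m)" unfolding F_def \<A>_def by blast
      show "finite (A ` F) \<and> card (A ` F) \<le> k"
        using k[of m p] unfolding F_def[symmetric] by (meson card_image_le finite_imageI le_trans)
    qed
    then have W: "chains_within (1/2 * t ^ m) (d * t ^ m) W"
      by (rule chains_within_mono) (use d tm in auto)
    have inW: "v \<in> W" if v: "v \<in> K" "dist p v \<le> t ^ m" for v
    proof -
      obtain y where "y \<in> L m" "v \<in> A y" using ex_cell[OF v(1)] by blast
      then show ?thesis using v unfolding W_def F_def by fastforce
    qed
    have "(p, q) \<in> chain_linked (d * t ^ m) W \<and> q \<in> W"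
      using pq
    proof (induction rule: chain_linked_induct)
      case refl
      then show ?case using inW p tm chain_linked_refl by auto
    next
      case (step q q')
      have "dist p q \<le> 1/2 * t ^ m" using chains_withinD[OF W] step by blast
      moreover have "dist q q' \<le> 1/2 * t ^ m"
        using step.hyps(4) mult_right_mono[OF d(3), of "t ^ m"] tm by linarith
      ultimately have "dist p q' \<le> t ^ m" using dist_triangle[of p q' q] by linarith
      then have "q' \<in> W" using inW step by blast
      then show ?case using step chain_linked_step by blast
    qed
    then show ?thesis using chains_withinD[OF W] tm by force
  qed
  then show ?thesis using d by blast
qed

text \<open>
  A horizontal path of level \<open>n\<close> follows a chain of steps \<open>O(t ^ n)\<close> in \<open>K\<close>.  Such a chain is
  confined at level \<open>n - j\<close> for a constant \<open>j\<close>, so the cells of all vertices of the path meet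
  one ball of radius \<open>O(t ^ n)\<close>, and only boundedly many cells do.
\<close>

lemma totally_disconnected_imp_bounded_components:
  assumes "bounded_degree V E" and "totally_disconnected_space (top_of_set K)"
  shows "bounded_horizontal_components L Eh"
proof -
  obtain d where d: "d > 0"
    "\<And>m p q. p \<in> K \<Longrightarrow> (p, q) \<in> chain_linked (d * t ^ m) K \<Longrightarrow> dist p q \<le> t ^ m"
    using chains_confined[OF assms] by blast
  obtain j where j: "t ^ j < d / stride"
    using real_arch_pow_inv[of "d / stride" t] d stride t by auto
  \<comment> \<open>the term \<open>diam\<close> takes care of the levels below \<open>j\<close>\<close>
  define R where "R = (1 + diam) / t ^ j"
  obtain k where k: "\<And>n p. finite {y \<in> L n. A y \<inter> cball p (R * t ^ n) \<noteq> {}} \<and>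
      card {y \<in> L n. A y \<inter> cball p (R * t ^ n) \<noteq> {}} \<le> k"
    using bounded_degree_imp_few_cells[OF assms(1)] by blast
  have "finite T \<and> card T \<le> k" if T: "horizontal_component L Eh T" for T
  proof -
    obtain n x where x: "x \<in> L n" "T = Eh\<^sup>* `` {x}"
      using T unfolding horizontal_component_iff by blast
    obtain p where p: "p \<in> A x" using cell_nonempty x by blast
    have pK: "p \<in> K" using p x cell_subset by blast
    have path: "\<forall>q\<in>A y. (p, q) \<in> chain_linked (stride * t ^ n) K" if "(x, y) \<in> Eh\<^sup>*" for y
      using that
    proof (induction rule: rtrancl_induct)
      case base
      show ?case
      proof
        fix q assume q: "q \<in> A x"
        have "diam * t ^ n \<le> stride * t ^ n" using stride t by (intro mult_right_mono) auto
        then have "dist p q \<le> stride * t ^ n" using cell_dist[OF x(1) p q] by linarith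
        then show "(p, q) \<in> chain_linked (stride * t ^ n) K"
          using chain_linked_step[OF chain_linked_refl pK] q cell_subset[OF x(1)] by blast
      qed
    next
      case (step y z)
      have yz: "y \<in> L n" "z \<in> L n"
        using step Eh_rtrancl_level[OF step(1)] Eh_level[OF step(2)] x by auto
      obtain u where u: "u \<in> A y" using cell_nonempty yz by blast
      show ?case
      proof
        fix q assume q: "q \<in> A z"
        have "u \<in> K" "q \<in> K" using u q yz cell_subset by blast+
        then show "(p, q) \<in> chain_linked (stride * t ^ n) K"
          using chain_linked_step step.IH u Eh_dist[OF step.hyps(2) yz(1) u q] by blast
      qed
    qed
    have "T \<subseteq> {y \<in> L n. A y \<inter> cball p (R * t ^ n) \<noteq> {}}"
    proof
      fix y assume "y \<in> T"
      then have y: "(x, y) \<in> Eh\<^sup>*" "y \<in> L n" using x Eh_rtrancl_level by auto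
      obtain q where q: "q \<in> A y" using cell_nonempty y by blast
      have qK: "q \<in> K" using q y cell_subset by blast
      have "dist p q \<le> R * t ^ n"
      proof (cases "j \<le> n")
        case True
        have tn: "t ^ n = t ^ j * t ^ (n - j)" using True by (simp add: power_add[symmetric])
        have "stride * t ^ j \<le> d" using j stride by (simp add: field_simps)
        then have "stride * t ^ n \<le> d * t ^ (n - j)"
          using mult_right_mono[of "stride * t ^ j" d "t ^ (n - j)"] t by (simp add: tn mult_ac)
        then have "(p, q) \<in> chain_linked (d * t ^ (n - j)) K"
          using path[OF y(1)] q chain_linked_mono by blast
        then have "dist p q \<le> t ^ (n - j)" using d(2) pK by blast
        also have "\<dots> \<le> R * t ^ n"
          using t diam_nonneg by (simp add: R_def tn field_simps)
        finally show ?thesis .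
      next
        case False
        then have "t ^ j \<le> t ^ n" using t by (intro power_decreasing) auto
        then have "diam * 1 \<le> (1 + diam) * (t ^ n / t ^ j)"
          using t diam_nonneg by (intro mult_mono) auto
        then show ?thesis using K_dist[OF pK qK] by (simp add: R_def)
      qed
      then show "y \<in> {y \<in> L n. A y \<inter> cball p (R * t ^ n) \<noteq> {}}" using y q by auto
    qed
    then show ?thesis using k[of n p] by (meson card_mono finite_subset le_trans)
  qed
  then show ?thesis unfolding bounded_horizontal_components_def by blast
qed

end

section \<open>The Gromov product\<close>

context cell_graph begin

lemma E_sym: "(x, y) \<in> E \<Longrightarrow> (y, x) \<in> E"
  using Ev_sym Eh_sym by (auto dest: symD)

lemma E_relpow_sym: "(x, y) \<in> E ^^ k \<Longrightarrow> (y, x) \<in> E ^^ k"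
proof (induction k arbitrary: y)
  case (Suc k)
  from Suc.prems obtain z where z: "(x, z) \<in> E ^^ k" "(z, y) \<in> E" by (rule relpow_Suc_E)
  show ?case by (rule relpow_Suc_I2[OF E_sym[OF z(2)] Suc.IH[OF z(1)]])
qed simp

lemma Ev_level_step:
  assumes "(x, y) \<in> Ev" "x \<in> L m"
  shows "y \<in> L (Suc m) \<and> A y \<subseteq> A x \<or> (\<exists>k. m = Suc k \<and> y \<in> L k \<and> A x \<subseteq> A y)"
  using Ev_levels[OF assms(1)] level_unique[OF assms(2)] by blast

lemma E_levels:
  assumes "(x, y) \<in> E" "x \<in> L m"
  shows "\<exists>n. y \<in> L n \<and> m \<le> Suc n \<and> n \<le> Suc m"
  using assms(1)
proof
  assume "(x, y) \<in> Ev"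
  from Ev_level_step[OF this assms(2)] show ?thesis by auto
next
  assume "(x, y) \<in> Eh"
  then have "y \<in> L m" using Eh_level assms(2) by blast
  then show ?thesis by auto
qed

lemma relpow_in_V:
  assumes "(x, y) \<in> E ^^ k" "x \<in> L m" shows "\<exists>n. y \<in> L n"
  using assms
proof (induction k arbitrary: y)
  case (Suc k)
  then show ?case using E_levels by (metis relpow_Suc_E)
qed auto

lemma relpow_level:
  assumes "(x, y) \<in> E ^^ k" "x \<in> L m" "y \<in> L n"
  shows "m \<le> n + k"
  using assms(1,3)
proof (induction k arbitrary: y n)
  case 0
  then show ?case using assms(2) level_unique by fastforce
next
  case (Suc k)
  then obtain z where z: "(x, z) \<in> E ^^ k" "(z, y) \<in> E" by auto
  obtain l where l: "z \<in> L l" "l \<le> Suc n"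
    using E_levels[OF E_sym[OF z(2)] Suc.prems(2)] by blast
  then show ?case using Suc.IH[OF z(1) l(1)] by simp
qed

lemma ex_ancestor:
  assumes "x \<in> L m" "k \<le> m"
  shows "\<exists>x'\<in>L k. (x, x') \<in> E ^^ (m - k) \<and> A x \<subseteq> A x'"
  using assms
proof (induction "m - k" arbitrary: m x)
  case 0
  then show ?case by auto
next
  case (Suc i)
  then obtain n where n: "m = Suc n" "k \<le> n" "i = n - k" by (cases m) auto
  obtain z where z: "z \<in> L n" "(z, x) \<in> Ev" using parent Suc.prems n by blast
  have sub: "A x \<subseteq> A z"
    using Ev_level_step[OF z(2,1)] Suc.prems(1) level_unique[of x] n by fastforce
  obtain x' where x': "x' \<in> L k" "(z, x') \<in> E ^^ (n - k)" "A z \<subseteq> A x'"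
    using Suc.hyps(1)[OF n(3) z(1) n(2)] by blast
  have "(x, z) \<in> E" using z Ev_sym by (auto dest: symD)
  from relpow_Suc_I2[OF this x'(2)] have "(x, x') \<in> E ^^ (m - k)"
    using n by (simp add: Suc_diff_le)
  then show ?case using x' sub by blast
qed

lemma relpow_root: "x \<in> L n \<Longrightarrow> (root, x) \<in> E ^^ n"
  using ex_ancestor[of x n 0] level_0 E_relpow_sym by fastforce

lemma graph_dist_le: "(x, y) \<in> E ^^ k \<Longrightarrow> graph_dist E x y \<le> k"
  unfolding graph_dist_def by (rule Least_le)

lemma graph_dist_relpow:
  assumes "x \<in> V" "y \<in> V"
  shows "(x, y) \<in> E ^^ graph_dist E x y"
proof -
  obtain m n where "(root, x) \<in> E ^^ m" "(root, y) \<in> E ^^ n"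
    using assms relpow_root by blast
  then have "(x, y) \<in> E ^^ (m + n)"
    unfolding relpow_add using E_relpow_sym by blast
  then show ?thesis unfolding graph_dist_def by (rule LeastI)
qed

lemma graph_dist_root:
  assumes "x \<in> L n" shows "graph_dist E root x = n"
proof (rule antisym)
  show "graph_dist E root x \<le> n" using graph_dist_le relpow_root assms by blast
  have "(root, x) \<in> E ^^ graph_dist E root x"
    using assms level_0 by (intro graph_dist_relpow) auto
  then show "n \<le> graph_dist E root x"
    using relpow_level[OF E_relpow_sym assms, of root _ 0] level_0 by simp
qed

abbreviation gprod :: "'v \<Rightarrow> 'v \<Rightarrow> real" where "gprod \<equiv> gromov_product E root"

lemma gprod_eq:
  assumes "x \<in> L m" "y \<in> L n"
  shows "gprod x y = (real m + real n - real (graph_dist E x y)) / 2"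
  using assms by (simp add: gromov_product_def graph_dist_root)

lemma gprod_le_level:
  assumes "x \<in> L m" "y \<in> L n"
  shows "gprod x y \<le> m" "gprod x y \<le> n"
proof -
  have r: "(x, y) \<in> E ^^ graph_dist E x y"
    using assms by (intro graph_dist_relpow) auto
  show "gprod x y \<le> m" "gprod x y \<le> n"
    using relpow_level[OF r assms] relpow_level[OF E_relpow_sym[OF r] assms(2,1)]
    by (simp_all add: gprod_eq[OF assms])
qed

definition drift :: real where "drift = stride / (1 - t)"

lemma drift_nonneg: "drift \<ge> 0"
  using stride t by (simp add: drift_def)

text \<open>
  The first \<open>k\<close> steps of a path that starts at level \<open>m\<close> stay at levels at least \<open>m - k\<close>; the
  displacement of the cells is bounded by a geometric series dominated by its last term.
\<close>

lemma dist_relpow: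
  assumes "(x, y) \<in> E ^^ k" "k \<le> m" "x \<in> L m" "p \<in> A x" "q \<in> A y"
  shows "dist p q \<le> drift * t ^ (m - k)"
  using assms(1,2,5)
proof (induction k arbitrary: y q)
  case 0
  have "stride \<le> drift"
    using stride t by (simp add: drift_def field_simps mult_left_le)
  then have "diam * t ^ m \<le> drift * t ^ m" using stride t by (intro mult_right_mono) auto
  moreover have "q \<in> A x" using 0 by simp
  ultimately show ?case using cell_dist[OF assms(3,4)] by fastforce
next
  case (Suc k)
  then obtain z where z: "(x, z) \<in> E ^^ k" "(z, y) \<in> E" by auto
  obtain n where n: "z \<in> L n" using relpow_in_V[OF z(1) assms(3)] by blast
  have "m \<le> n + k" using relpow_level[OF z(1) assms(3) n] .
  then have l: "m - Suc k \<le> n" "m - Suc k \<le> n - 1" by auto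
  obtain u where u: "u \<in> A z" using cell_nonempty n by blast
  have pow: "stride * t ^ i \<le> stride * t ^ (m - Suc k)" if "m - Suc k \<le> i" for i
    using that t stride by (intro mult_left_mono power_decreasing) auto
  have dpow: "diam * t ^ i \<le> stride * t ^ (m - Suc k)" if "m - Suc k \<le> i" for i
    using pow[OF that] mult_right_mono[OF stride(2), of "t ^ i"] t zero_le_power[of t i] by linarith
  have "dist u q \<le> stride * t ^ (m - Suc k)"
    using z(2)
  proof
    assume "(z, y) \<in> Eh"
    then show ?thesis using Eh_dist[OF _ n u Suc.prems(3)] pow[OF l(1)] by linarith
  next
    assume "(z, y) \<in> Ev"
    from Ev_level_step[OF this n] show ?thesis
    proof (elim disjE conjE exE)
      assume "A y \<subseteq> A z"
      then have "q \<in> A z" using Suc.prems by blast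
      then show ?thesis using cell_dist[OF n u, of q] dpow[OF l(1)] by linarith
    next
      fix i assume i: "n = Suc i" "y \<in> L i" "A z \<subseteq> A y"
      then have "u \<in> A y" using u by blast
      then show ?thesis using cell_dist[OF i(2), of u q] Suc.prems dpow[of i] l(2) i(1) by fastforce
    qed
  qed
  moreover have "dist p u \<le> drift * t ^ (m - k)" using Suc.IH[OF z(1) _ u] Suc.prems by simp
  moreover have "drift * t ^ (m - k) + stride * t ^ (m - Suc k) = drift * t ^ (m - Suc k)"
  proof -
    have "drift * t + stride = drift"
      using t by (simp add: drift_def field_simps)
    moreover have "t ^ (m - k) = t * t ^ (m - Suc k)"
      using Suc.prems(2) by (metis Suc_diff_le diff_Suc_Suc power_Suc)
    ultimately show ?thesis by (metis distrib_right mult.assoc)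
  qed
  ultimately show ?case using dist_triangle[of p q u] by linarith
qed

text \<open>
  A geodesic can be cut into a part of at most \<open>m - G\<close> steps from \<open>x\<close> and one of at most \<open>n - G\<close>
  steps from \<open>y\<close>; the previous lemma bounds the displacement along each.
\<close>

lemma dist_le_if_gprod:
  assumes "x \<in> L m" "y \<in> L n" "real G \<le> gprod x y" "p \<in> A x" "q \<in> A y"
  shows "dist p q \<le> 2 * drift * t ^ G"
proof -
  let ?l = "graph_dist E x y"
  have "real G \<le> m" "real G \<le> n"
    using gprod_le_level[OF assms(1,2)] assms(3) by linarith+
  then have G: "G \<le> m" "G \<le> n" by auto
  have "2 * real G + real ?l \<le> real m + real n"
    using assms(3) by (simp add: gprod_eq[OF assms(1,2)])
  then have l: "2 * G + ?l \<le> m + n" by linarith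
  define i where "i = min ?l (m - G)"
  have i: "i \<le> m - G" "?l - i \<le> n - G" "i + (?l - i) = ?l" using l G by (auto simp: i_def)
  have "(x, y) \<in> E ^^ (i + (?l - i))"
    using assms unfolding i(3) by (intro graph_dist_relpow) auto
  then obtain z where z: "(x, z) \<in> E ^^ i" "(z, y) \<in> E ^^ (?l - i)"
    unfolding relpow_add by blast
  obtain u where u: "u \<in> A z" using relpow_in_V[OF z(1) assms(1)] cell_nonempty by blast
  have pow: "drift * t ^ j \<le> drift * t ^ G" if "G \<le> j" for j
    using that t drift_nonneg by (intro mult_left_mono power_decreasing) auto
  have "dist p u \<le> drift * t ^ (m - i)"
    using dist_relpow[OF z(1) _ assms(1,4) u] i by linarith
  moreover have "dist q u \<le> drift * t ^ (n - (?l - i))"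
    using dist_relpow[OF E_relpow_sym[OF z(2)] _ assms(2,5) u] i by linarith
  ultimately show ?thesis
    using pow[of "m - i"] pow[of "n - (?l - i)"] i G dist_triangle2[of p q u] by linarith
qed

text \<open>
  Conversely, if the cells of \<open>x\<close> and \<open>y\<close> are close, then their ancestors at level \<open>k\<close> are equal or
  adjacent, and the path through these ancestors bounds the graph distance.  The single horizontal
  edge costs the \<open>1/2\<close>.
\<close>

lemma gprod_ge_if_close:
  assumes "x \<in> L m" "y \<in> L n" "k \<le> m" "k \<le> n" "p \<in> A x" "q \<in> A y" "dist p q \<le> \<kappa> * t ^ k"
  shows "gprod x y \<ge> real k - 1/2"
proof -
  obtain x' where x': "x' \<in> L k" "(x, x') \<in> E ^^ (m - k)" "A x \<subseteq> A x'"
    using ex_ancestor assms by blast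
  obtain y' where y': "y' \<in> L k" "(y, y') \<in> E ^^ (n - k)" "A y \<subseteq> A y'"
    using ex_ancestor assms by blast
  have "graph_dist E x y \<le> (m - k) + 1 + (n - k)"
  proof (cases "x' = y'")
    case True
    then have "(x, y) \<in> E ^^ ((m - k) + (n - k))"
      unfolding relpow_add using x' E_relpow_sym[OF y'(2)] by blast
    then show ?thesis using graph_dist_le by fastforce
  next
    case False
    have "(x', y') \<in> Eh"
      using Eh_if_close[OF x'(1) y'(1) False, of p q] assms x' y' by blast
    then have "(x', y') \<in> E ^^ 1" by simp
    then have "(x, y) \<in> E ^^ ((m - k) + 1 + (n - k))"
      unfolding relpow_add using x' E_relpow_sym[OF y'(2)] by blast
    then show ?thesis by (rule graph_dist_le)
  qed
  then have "real (graph_dist E x y) \<le> real m - k + 1 + (real n - k)"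
    using assms(3,4) by (metis (no_types, opaque_lifting) of_nat_1 of_nat_add of_nat_diff of_nat_le_iff)
  then show ?thesis by (simp add: gprod_eq[OF assms(1,2)])
qed

end

section \<open>The hyperbolic boundary\<close>

lemma cauchy_seqs_range: "x \<in> cauchy_seqs W \<rho> \<Longrightarrow> range x \<subseteq> W"
  by (simp add: cauchy_seqs_def)

locale cell_graph_boundary = cell_graph L A Ev Eh K \<kappa> t root
  for L :: "nat \<Rightarrow> 'v set" and A :: "'v \<Rightarrow> 'a::euclidean_space set"
    and Ev Eh :: "('v \<times> 'v) set" and K :: "'a set" and \<kappa> t :: real and root :: 'v +
  fixes a :: real assumes a: "a > 0"
begin

abbreviation rho :: "'v \<Rightarrow> 'v \<Rightarrow> real" where "rho \<equiv> gromov_rho a E root"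

abbreviation completion :: "(nat \<Rightarrow> 'v) set set" where "completion \<equiv> seq_completion V rho"

abbreviation embed :: "'v \<Rightarrow> (nat \<Rightarrow> 'v) set" where "embed \<equiv> completion_embed V rho"

definition lev :: "'v \<Rightarrow> nat" where "lev x = (THE n. x \<in> L n)"

lemma lev_eq: "x \<in> L n \<Longrightarrow> lev x = n"
  unfolding lev_def using level_unique by blast

lemma lev: "x \<in> V \<Longrightarrow> x \<in> L (lev x)"
  using lev_eq by auto

definition pt :: "'v \<Rightarrow> 'a" where "pt x = (SOME p. p \<in> A x)"

lemma pt: "x \<in> V \<Longrightarrow> pt x \<in> A x"
  unfolding pt_def using cell_nonempty by (auto simp: some_in_eq)

lemma pt_K: "x \<in> V \<Longrightarrow> pt x \<in> K"
  using pt cell_subset lev by blast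

lemma rho_self [simp]: "rho x x = 0"
  by (simp add: gromov_rho_def)

lemma rho_nonneg: "rho x y \<ge> 0"
  by (simp add: gromov_rho_def)

lemma rho_less_cases: "rho x y < exp (- a * G) \<Longrightarrow> x = y \<or> G < gprod x y"
  using a by (auto simp: gromov_rho_def split: if_splits)

lemma rho_less_lev:
  assumes "x \<in> V" "y \<in> V" "rho x y < exp (- a * real (lev x))"
  shows "x = y"
  using rho_less_cases[OF assms(3)] gprod_le_level(1)[OF lev lev, OF assms(1,2)] by linarith

lemma rho_less_imp_dist:
  assumes "x \<in> V" "y \<in> V" "rho x y < exp (- a * real G)"
  shows "dist (pt x) (pt y) \<le> 2 * drift * t ^ G"
  using rho_less_cases[OF assms(3)]
proof
  assume "x = y"
  then show ?thesis using drift_nonneg t by simp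
next
  assume "real G < gprod x y"
  then show ?thesis using dist_le_if_gprod[OF lev lev _ pt pt] assms by simp
qed

lemma dist_le_imp_rho:
  assumes "x \<in> V" "y \<in> V" "k \<le> lev x" "k \<le> lev y" "dist (pt x) (pt y) \<le> \<kappa> * t ^ k"
  shows "rho x y \<le> exp (- a * (real k - 1/2))"
  using gprod_ge_if_close[OF lev lev assms(3,4) pt pt assms(5)] assms(1,2) a
  by (simp add: gromov_rho_def)

lemma ex_exp_less: "e > 0 \<Longrightarrow> \<exists>k::nat. exp (- a * (real k - 1/2)) < e"
proof -
  assume e: "e > 0"
  obtain k :: nat where "1/2 - ln e / a < real k" using reals_Archimedean2 by blast
  then have "- a * (real k - 1/2) < ln e" using a by (simp add: field_simps)
  then have "exp (- a * (real k - 1/2)) < exp (ln e)" by (simp only: exp_less_mono)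
  then show ?thesis using e by auto
qed

lemma ex_drift_less: "e > 0 \<Longrightarrow> \<exists>G::nat. 2 * drift * t ^ G < e"
proof -
  assume e: "e > 0"
  have "(\<lambda>G. 2 * drift * t ^ G) \<longlonglongrightarrow> 0"
    using t by (intro tendsto_mult_right_zero LIMSEQ_power_zero) auto
  then show ?thesis
    using order_tendstoD(2)[OF _ e] by (metis eventually_sequentially order_refl)
qed

text \<open>
  By \<open>Cauchy_deep_or_const\<close>, a Cauchy sequence is of this kind or eventually constant; in the first
  case it represents a boundary point, in the second a vertex.
\<close>

definition deep :: "(nat \<Rightarrow> 'v) \<Rightarrow> bool" where
  "deep x \<longleftrightarrow> range x \<subseteq> V \<and> (\<forall>k. \<forall>\<^sub>F n in sequentially. k \<le> lev (x n))"

lemma deep_V: "deep x \<Longrightarrow> x n \<in> V"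
  unfolding deep_def by blast

lemma not_deep_if_eventually_const:
  assumes "deep x" "\<forall>\<^sub>F n in sequentially. x n = v" shows False
proof -
  have "\<forall>\<^sub>F n in sequentially. Suc (lev v) \<le> lev (x n)" using assms(1) unfolding deep_def by blast
  then have "\<forall>\<^sub>F n in sequentially. False" using assms(2) by eventually_elim auto
  then show False by simp
qed

lemma deep_Cauchy_iff:
  assumes x: "deep x"
  shows "x \<in> cauchy_seqs V rho \<longleftrightarrow> Cauchy (\<lambda>n. pt (x n))"
proof
  assume c: "x \<in> cauchy_seqs V rho"
  show "Cauchy (\<lambda>n. pt (x n))"
    unfolding Cauchy_def
  proof (intro allI impI)
    fix e :: real assume "e > 0"
    then obtain G where G: "2 * drift * t ^ G < e" using ex_drift_less by blast
    obtain M where "\<forall>m\<ge>M. \<forall>n\<ge>M. rho (x m) (x n) < exp (- a * real G)"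
      using c unfolding cauchy_seqs_def by (fastforce dest: spec[of _ "exp (- a * real G)"])
    then show "\<exists>M. \<forall>m\<ge>M. \<forall>n\<ge>M. dist (pt (x m)) (pt (x n)) < e"
      using rho_less_imp_dist[OF deep_V deep_V, OF x x] G by (meson le_less_trans)
  qed
next
  assume c: "Cauchy (\<lambda>n. pt (x n))"
  have "\<exists>M. \<forall>m\<ge>M. \<forall>n\<ge>M. rho (x m) (x n) < e" if e: "e > 0" for e
  proof -
    obtain k :: nat where k: "exp (- a * (real k - 1/2)) < e" using ex_exp_less[OF e] by blast
    obtain M1 where M1: "\<forall>n\<ge>M1. k \<le> lev (x n)"
      using x unfolding deep_def eventually_sequentially by blast
    have "\<kappa> * t ^ k > 0" using \<kappa> t by simp
    then obtain M2 where M2: "\<forall>m\<ge>M2. \<forall>n\<ge>M2. dist (pt (x m)) (pt (x n)) < \<kappa> * t ^ k"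
      using c unfolding Cauchy_def by blast
    have "rho (x m) (x n) < e" if "m \<ge> max M1 M2" "n \<ge> max M1 M2" for m n
    proof -
      have "dist (pt (x m)) (pt (x n)) \<le> \<kappa> * t ^ k" using M2 that by (simp add: less_imp_le)
      then show ?thesis
        using dist_le_imp_rho[OF deep_V[OF x] deep_V[OF x], of k m n] M1 that k by auto
    qed
    then show ?thesis by blast
  qed
  then show "x \<in> cauchy_seqs V rho"
    using x unfolding cauchy_seqs_def deep_def by blast
qed

lemma limit_dist_le:
  assumes "deep x" "deep y" "(\<lambda>n. pt (x n)) \<longlonglongrightarrow> p" "(\<lambda>n. pt (y n)) \<longlonglongrightarrow> q"
    and "\<forall>\<^sub>F n in sequentially. rho (x n) (y n) < exp (- a * real G)"
  shows "dist p q \<le> 2 * drift * t ^ G"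
proof (rule tendsto_upperbound[OF tendsto_dist[OF assms(3,4)]])
  show "\<forall>\<^sub>F n in sequentially. dist (pt (x n)) (pt (y n)) \<le> 2 * drift * t ^ G"
    using assms(5)
    by eventually_elim (rule rho_less_imp_dist[OF deep_V[OF assms(1)] deep_V[OF assms(2)]])
qed simp

lemma eventually_rho_le:
  assumes x: "deep x" and y: "deep y" and l: "(\<lambda>n. pt (x n)) \<longlonglongrightarrow> p" "(\<lambda>n. pt (y n)) \<longlonglongrightarrow> q"
    and d: "dist p q < \<kappa> * t ^ k"
  shows "\<forall>\<^sub>F n in sequentially. rho (x n) (y n) \<le> exp (- a * (real k - 1/2))"
proof -
  have "\<forall>\<^sub>F n in sequentially. dist (pt (x n)) (pt (y n)) < \<kappa> * t ^ k"
    using order_tendstoD(2)[OF tendsto_dist[OF l] d] .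
  moreover have "\<forall>\<^sub>F n in sequentially. k \<le> lev (x n)" "\<forall>\<^sub>F n in sequentially. k \<le> lev (y n)"
    using x y unfolding deep_def by blast+
  ultimately show ?thesis
    by eventually_elim (intro dist_le_imp_rho deep_V x y; simp)
qed

lemma rho_tendsto_0_iff:
  assumes x: "deep x" and y: "deep y" and l: "(\<lambda>n. pt (x n)) \<longlonglongrightarrow> p" "(\<lambda>n. pt (y n)) \<longlonglongrightarrow> q"
  shows "(\<lambda>n. rho (x n) (y n)) \<longlonglongrightarrow> 0 \<longleftrightarrow> p = q"
proof
  assume r: "(\<lambda>n. rho (x n) (y n)) \<longlonglongrightarrow> 0"
  have "dist p q < e" if "e > 0" for e
  proof -
    obtain G where G: "2 * drift * t ^ G < e" using ex_drift_less \<open>e > 0\<close> by blast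
    have "\<forall>\<^sub>F n in sequentially. rho (x n) (y n) < exp (- a * real G)"
      by (rule order_tendstoD(2)[OF r]) simp
    from limit_dist_le[OF assms this] show ?thesis using G by linarith
  qed
  then show "p = q" by (metis dist_nz less_irrefl)
next
  assume pq: "p = q"
  show "(\<lambda>n. rho (x n) (y n)) \<longlonglongrightarrow> 0"
  proof (rule order_tendstoI)
    fix e :: real assume "0 < e"
    then obtain k :: nat where k: "exp (- a * (real k - 1/2)) < e" using ex_exp_less by blast
    have "dist p q < \<kappa> * t ^ k" using pq \<kappa> t by simp
    from eventually_rho_le[OF assms this] show "\<forall>\<^sub>F n in sequentially. rho (x n) (y n) < e"
      by eventually_elim (use k in linarith)
  next
    fix e :: real assume "e < 0"
    then show "\<forall>\<^sub>F n in sequentially. e < rho (x n) (y n)"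
      using rho_nonneg less_le_trans by (intro always_eventually) blast
  qed
qed

lemma deep_if_rho_tendsto_0:
  assumes x: "deep x" and y: "range y \<subseteq> V" and r: "(\<lambda>n. rho (x n) (y n)) \<longlonglongrightarrow> 0"
  shows "deep y"
  unfolding deep_def
proof (intro conjI allI y)
  fix k
  have "\<forall>\<^sub>F n in sequentially. rho (x n) (y n) < exp (- a * real k)"
    by (rule order_tendstoD(2)[OF r]) simp
  moreover have "\<forall>\<^sub>F n in sequentially. k \<le> lev (x n)" using x unfolding deep_def by blast
  ultimately show "\<forall>\<^sub>F n in sequentially. k \<le> lev (y n)"
  proof eventually_elim
    case (elim n)
    have V: "x n \<in> V" "y n \<in> V" using deep_V[OF x] y by blast+
    show ?case
      using rho_less_cases[OF elim(1)] gprod_le_level(2)[OF lev lev, OF V] elim(2) by auto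
  qed
qed

text \<open>The boundary point over \<open>q\<close>: the equivalence class of the sequences whose cells shrink to \<open>q\<close>.\<close>

definition point_over :: "'a \<Rightarrow> (nat \<Rightarrow> 'v) set" where
  "point_over q = {x. deep x \<and> (\<lambda>n. pt (x n)) \<longlonglongrightarrow> q}"

lemma point_over_nonempty:
  assumes "q \<in> K" shows "point_over q \<noteq> {}"
proof -
  have "\<exists>y. y \<in> L n \<and> q \<in> A y" for n using ex_cell[OF assms, of n] by blast
  then obtain x where x: "\<And>n. x n \<in> L n" "\<And>n. q \<in> A (x n)" by metis
  have "(\<lambda>n. pt (x n)) \<longlonglongrightarrow> q"
  proof (rule metric_tendsto_imp_tendsto)
    show "(\<lambda>n. diam * t ^ n) \<longlonglongrightarrow> 0"
      using t by (intro tendsto_mult_right_zero LIMSEQ_power_zero) auto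
    show "\<forall>\<^sub>F n in sequentially. dist (pt (x n)) q \<le> dist (diam * t ^ n) 0"
    proof (intro always_eventually allI)
      fix n
      have "dist (pt (x n)) q \<le> diam * t ^ n" using x pt by (intro cell_dist) blast+
      then show "dist (pt (x n)) q \<le> dist (diam * t ^ n) 0" by simp
    qed
  qed
  moreover have "deep x"
    unfolding deep_def
  proof (intro conjI allI)
    show "range x \<subseteq> V" using x by blast
    show "\<forall>\<^sub>F n in sequentially. k \<le> lev (x n)" for k
      using eventually_ge_at_top[of k] by (simp only: lev_eq[OF x(1)])
  qed
  ultimately show ?thesis unfolding point_over_def by blast
qed

lemma point_over_class:
  assumes "x \<in> point_over q"
  shows "x \<in> cauchy_seqs V rho" "cauchy_rel V rho `` {x} = point_over q"
proof -
  have x: "deep x" "(\<lambda>n. pt (x n)) \<longlonglongrightarrow> q" using assms by (auto simp: point_over_def)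
  have cauchy: "y \<in> cauchy_seqs V rho" if "deep y" "(\<lambda>n. pt (y n)) \<longlonglongrightarrow> q'" for y q'
    using deep_Cauchy_iff that LIMSEQ_imp_Cauchy by blast
  show xc: "x \<in> cauchy_seqs V rho" using cauchy x .
  show "cauchy_rel V rho `` {x} = point_over q"
  proof (intro set_eqI iffI)
    fix y assume "y \<in> cauchy_rel V rho `` {x}"
    then have y: "y \<in> cauchy_seqs V rho" "(\<lambda>n. rho (x n) (y n)) \<longlonglongrightarrow> 0"
      by (auto simp: cauchy_rel_def)
    then have d: "deep y"
      using deep_if_rho_tendsto_0[OF x(1)] cauchy_seqs_range by blast
    then obtain q' where q': "(\<lambda>n. pt (y n)) \<longlonglongrightarrow> q'"
      using deep_Cauchy_iff y(1) Cauchy_convergent convergent_def by blast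
    then have "q = q'" using rho_tendsto_0_iff[OF x(1) d x(2) q'] y(2) by blast
    then show "y \<in> point_over q" using d q' by (simp add: point_over_def)
  next
    fix y assume "y \<in> point_over q"
    then have y: "deep y" "(\<lambda>n. pt (y n)) \<longlonglongrightarrow> q" by (auto simp: point_over_def)
    then have "(\<lambda>n. rho (x n) (y n)) \<longlonglongrightarrow> 0"
      using rho_tendsto_0_iff[OF x(1) y(1) x(2) y(2)] by blast
    then show "y \<in> cauchy_rel V rho `` {x}"
      using xc cauchy[OF y] by (simp add: cauchy_rel_def)
  qed
qed

lemma rho_tendsto_0_const_iff:
  assumes "v \<in> V" "range y \<subseteq> V" "\<forall>\<^sub>F n in sequentially. x n = v"
  shows "(\<lambda>n. rho (x n) (y n)) \<longlonglongrightarrow> 0 \<longleftrightarrow> (\<forall>\<^sub>F n in sequentially. y n = v)"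
proof
  assume "(\<lambda>n. rho (x n) (y n)) \<longlonglongrightarrow> 0"
  then have "\<forall>\<^sub>F n in sequentially. rho (x n) (y n) < exp (- a * real (lev v))"
    by (rule order_tendstoD(2)) simp
  with assms(3) show "\<forall>\<^sub>F n in sequentially. y n = v"
  proof eventually_elim
    case (elim n)
    have "y n \<in> V" using assms(2) by blast
    then show ?case using rho_less_lev[OF assms(1), of "y n"] elim by simp
  qed
next
  assume "\<forall>\<^sub>F n in sequentially. y n = v"
  with assms(3) have "\<forall>\<^sub>F n in sequentially. rho (x n) (y n) = 0"
    by eventually_elim simp
  then show "(\<lambda>n. rho (x n) (y n)) \<longlonglongrightarrow> 0" by (rule tendsto_eventually)
qed

lemma eventually_const_class:
  assumes v: "v \<in> V" and x: "range x \<subseteq> V" "\<forall>\<^sub>F n in sequentially. x n = v"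
  shows "x \<in> cauchy_seqs V rho"
    and "cauchy_rel V rho `` {x} = {y. range y \<subseteq> V \<and> (\<forall>\<^sub>F n in sequentially. y n = v)}"
proof -
  have cauchy: "y \<in> cauchy_seqs V rho" if y: "range y \<subseteq> V" "\<forall>\<^sub>F n in sequentially. y n = v" for y
  proof -
    obtain M where "\<forall>n\<ge>M. y n = v" using y(2) unfolding eventually_sequentially by blast
    then have "\<forall>m\<ge>M. \<forall>n\<ge>M. rho (y m) (y n) = 0" by simp
    then show ?thesis using y(1) unfolding cauchy_seqs_def by (auto intro: exI[of _ M])
  qed
  show xc: "x \<in> cauchy_seqs V rho" using cauchy x .
  show "cauchy_rel V rho `` {x} = {y. range y \<subseteq> V \<and> (\<forall>\<^sub>F n in sequentially. y n = v)}"
  proof (intro set_eqI iffI)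
    fix y assume "y \<in> cauchy_rel V rho `` {x}"
    then have y: "y \<in> cauchy_seqs V rho" "(\<lambda>n. rho (x n) (y n)) \<longlonglongrightarrow> 0"
      by (simp_all add: cauchy_rel_def)
    then show "y \<in> {y. range y \<subseteq> V \<and> (\<forall>\<^sub>F n in sequentially. y n = v)}"
      using rho_tendsto_0_const_iff[OF v cauchy_seqs_range[OF y(1)] x(2)] cauchy_seqs_range[OF y(1)] by simp
  next
    fix y assume "y \<in> {y. range y \<subseteq> V \<and> (\<forall>\<^sub>F n in sequentially. y n = v)}"
    then have y: "range y \<subseteq> V" "\<forall>\<^sub>F n in sequentially. y n = v" by simp_all
    then show "y \<in> cauchy_rel V rho `` {x}"
      using rho_tendsto_0_const_iff[OF v y(1) x(2)] xc cauchy[OF y] by (simp add: cauchy_rel_def)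
  qed
qed

lemma embed_eq:
  assumes "v \<in> V"
  shows "embed v = {y. range y \<subseteq> V \<and> (\<forall>\<^sub>F n in sequentially. y n = v)}"
  unfolding completion_embed_def using assms by (intro eventually_const_class) auto

text \<open>
  A term \<open>x n\<close> of level less than \<open>k\<close> is isolated: \<open>rho (x n) y\<close> is at least \<open>exp (- a * k)\<close> for
  every other vertex \<open>y\<close>.  If such terms occur beyond the point where a Cauchy sequence varies by
  less than this, the sequence is constant from there on.
\<close>

lemma Cauchy_deep_or_const:
  assumes x: "x \<in> cauchy_seqs V rho"
  shows "deep x \<or> (\<exists>v\<in>V. \<forall>\<^sub>F n in sequentially. x n = v)"
proof (rule disjCI)
  assume not_const: "\<not> (\<exists>v\<in>V. \<forall>\<^sub>F n in sequentially. x n = v)"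
  have V: "x n \<in> V" for n using cauchy_seqs_range[OF x] by blast
  have "\<forall>\<^sub>F n in sequentially. k \<le> lev (x n)" for k
  proof -
    have "\<exists>M. \<forall>m\<ge>M. \<forall>n\<ge>M. rho (x m) (x n) < exp (- a * real k)"
      using x unfolding cauchy_seqs_def
      by (elim CollectE conjE allE[of _ "exp (- a * real k)"]) simp
    then obtain M where M: "\<And>m n. m \<ge> M \<Longrightarrow> n \<ge> M \<Longrightarrow> rho (x m) (x n) < exp (- a * real k)"
      by blast
    have "k \<le> lev (x n)" if n: "n \<ge> M" for n
    proof (rule ccontr)
      assume k: "\<not> k \<le> lev (x n)"
      have "x m = x n" if m: "m \<ge> M" for m
      proof -
        have "exp (- a * real k) \<le> exp (- a * real (lev (x n)))" using k a by simp
        from less_le_trans[OF M[OF n m] this] show ?thesis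
          using rho_less_lev[OF V V, of n m] by (simp only:)
      qed
      then have "\<forall>\<^sub>F m in sequentially. x m = x n" unfolding eventually_sequentially by blast
      then show False using not_const bexI[OF _ V, of "\<lambda>v. \<forall>\<^sub>F m in sequentially. x m = v" n] by simp
    qed
    then show ?thesis unfolding eventually_sequentially by blast
  qed
  moreover have "range x \<subseteq> V" by (rule image_subsetI) (rule V)
  ultimately show "deep x" unfolding deep_def by simp
qed

lemma completion_eq: "completion = point_over ` K \<union> embed ` V"
proof (intro subset_antisym subsetI)
  fix \<xi> assume "\<xi> \<in> completion"
  then obtain x where x: "x \<in> cauchy_seqs V rho" "\<xi> = cauchy_rel V rho `` {x}"
    unfolding seq_completion_def by (auto elim: quotientE)
  from Cauchy_deep_or_const[OF x(1)] show "\<xi> \<in> point_over ` K \<union> embed ` V"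
  proof
    assume d: "deep x"
    then obtain q where q: "(\<lambda>n. pt (x n)) \<longlonglongrightarrow> q"
      using deep_Cauchy_iff x(1) Cauchy_convergent convergent_def by blast
    have "q \<in> K"
      by (rule closed_sequentially[OF compact_imp_closed[OF K(1)] _ q]) (rule pt_K[OF deep_V[OF d]])
    moreover have "\<xi> = point_over q" using point_over_class(2)[of x q] x d q by (simp add: point_over_def)
    ultimately show ?thesis by blast
  next
    assume "\<exists>v\<in>V. \<forall>\<^sub>F n in sequentially. x n = v"
    then obtain v where v: "v \<in> V" "\<forall>\<^sub>F n in sequentially. x n = v" by blast
    have "\<xi> = embed v"
      using eventually_const_class(2)[OF v(1) cauchy_seqs_range[OF x(1)] v(2)] embed_eq[OF v(1)] x(2)
      by (simp only:)
    then show ?thesis using v by blast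
  qed
next
  fix \<xi> assume "\<xi> \<in> point_over ` K \<union> embed ` V"
  then show "\<xi> \<in> completion"
  proof
    assume "\<xi> \<in> point_over ` K"
    then obtain q x where "\<xi> = point_over q" "x \<in> point_over q" using point_over_nonempty by blast
    then show ?thesis
      unfolding seq_completion_def using point_over_class[of x q] by (metis quotientI)
  next
    assume "\<xi> \<in> embed ` V"
    then obtain v where "v \<in> V" "\<xi> = embed v" by blast
    then show ?thesis
      unfolding seq_completion_def completion_embed_def
      using eventually_const_class(1)[of v "\<lambda>_. v"] by (auto intro: quotientI)
  qed
qed

lemma point_over_embed_disjoint: "v \<in> V \<Longrightarrow> point_over q \<inter> embed v = {}"
  using embed_eq not_deep_if_eventually_const unfolding point_over_def by blast

lemma boundary_points: "completion - embed ` V = point_over ` K"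
  unfolding completion_eq using point_over_embed_disjoint point_over_nonempty by blast

lemma inj_point_over: "inj_on point_over K"
proof (rule inj_onI)
  fix p q assume pq: "p \<in> K" "q \<in> K" "point_over p = point_over q"
  then obtain x where "x \<in> point_over p" "x \<in> point_over q" using point_over_nonempty by blast
  then show "p = q" unfolding point_over_def using LIMSEQ_unique by blast
qed

lemma near_imp_dist:
  assumes "completion_near rho (exp (- a * real G)) (point_over p) (point_over q)"
  shows "dist p q \<le> 2 * drift * t ^ G"
proof -
  obtain x y where "deep x" "deep y" "(\<lambda>n. pt (x n)) \<longlonglongrightarrow> p" "(\<lambda>n. pt (y n)) \<longlonglongrightarrow> q"
    "\<forall>\<^sub>F n in sequentially. rho (x n) (y n) < exp (- a * real G)"
    using assms unfolding completion_near_def point_over_def by blast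
  then show ?thesis by (rule limit_dist_le)
qed

lemma dist_imp_near:
  assumes "p \<in> K" "q \<in> K" "dist p q < \<kappa> * t ^ k" "exp (- a * (real k - 1/2)) < e"
  shows "completion_near rho e (point_over p) (point_over q)"
proof -
  obtain x y where xy: "x \<in> point_over p" "y \<in> point_over q"
    using assms point_over_nonempty by blast
  then have "\<forall>\<^sub>F n in sequentially. rho (x n) (y n) \<le> exp (- a * (real k - 1/2))"
    using assms(3) unfolding point_over_def by (intro eventually_rho_le) auto
  then have "\<forall>\<^sub>F n in sequentially. rho (x n) (y n) < e"
    by eventually_elim (use assms(4) in linarith)
  then show ?thesis unfolding completion_near_def using xy by blast
qed

text \<open>
  Vertices are isolated points of the completion: no vertex other than \<open>v\<close> has \<open>rho\<close>-distance less
  than \<open>exp (- a * lev v)\<close> to \<open>v\<close>, so sequences that stay so near to \<open>v\<close> are eventually \<open>v\<close>.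
\<close>

lemma near_embed:
  assumes v: "v \<in> V" and \<eta>: "\<eta> \<in> completion"
    and near: "completion_near rho (exp (- a * real (lev v))) (embed v) \<eta>"
  shows "\<eta> = embed v"
proof -
  obtain x y where x: "\<forall>\<^sub>F n in sequentially. x n = v" and y: "y \<in> \<eta>"
    and xy: "\<forall>\<^sub>F n in sequentially. rho (x n) (y n) < exp (- a * real (lev v))"
    using near embed_eq[OF v] unfolding completion_near_def by blast
  have yV: "y n \<in> V" for n
  proof -
    have "deep y \<or> range y \<subseteq> V"
      using \<eta> y embed_eq unfolding completion_eq point_over_def by blast
    then show ?thesis using deep_V by blast
  qed
  have ev: "\<forall>\<^sub>F n in sequentially. y n = v"
    using x xy
  proof eventually_elim
    case (elim n)
    then show ?case using rho_less_lev[OF v yV, of n] by simp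
  qed
  from \<eta>[unfolded completion_eq] show ?thesis
  proof
    assume "\<eta> \<in> point_over ` K"
    then show ?thesis using y ev not_deep_if_eventually_const unfolding point_over_def by blast
  next
    assume "\<eta> \<in> embed ` V"
    then obtain w where w: "w \<in> V" "\<eta> = embed w" by blast
    then have "\<forall>\<^sub>F n in sequentially. y n = w" using y embed_eq by blast
    with ev have "\<forall>\<^sub>F n in sequentially. v = w" by eventually_elim simp
    then show ?thesis using w by simp
  qed
qed

text \<open>
  The estimates above compare nearness of boundary points with distance in \<open>K\<close>.  The open sets of
  the boundary are traces of open sets of the whole completion; adding all vertices to a set of
  boundary points makes such an open set, because vertices are isolated.
\<close>

lemma homeomorphic_boundary:
  "homeomorphic_map (top_of_set K) (hyperbolic_boundary a V E root) point_over"
proof (rule bijective_open_imp_homeomorphic_map)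
  have openin: "openin (hyperbolic_boundary a V E root) U \<longleftrightarrow>
      (\<exists>U'. completion_open V rho U' \<and> U = U' \<inter> point_over ` K)" for U
    by (simp only: hyperbolic_boundary_def completion_boundary_def openin_subtopology
        openin_completion_topology boundary_points)
  have top: "topspace (hyperbolic_boundary a V E root) = point_over ` K"
    by (simp only: hyperbolic_boundary_def completion_boundary_def topspace_subtopology
        topspace_completion_topology boundary_points
        Int_absorb1[OF Diff_subset[of completion "embed ` V"], unfolded boundary_points])
  show "point_over ` topspace (top_of_set K) = topspace (hyperbolic_boundary a V E root)"
    by (simp add: top)
  show "inj_on point_over (topspace (top_of_set K))" using inj_point_over by simp
  show "continuous_map (top_of_set K) (hyperbolic_boundary a V E root) point_over"
    unfolding continuous_map_def
  proof (intro conjI allI impI)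
    show "point_over \<in> topspace (top_of_set K) \<rightarrow> topspace (hyperbolic_boundary a V E root)"
      by (auto simp: top)
    fix U assume "openin (hyperbolic_boundary a V E root) U"
    then obtain U' where U': "completion_open V rho U'" "U = U' \<inter> point_over ` K"
      unfolding openin by blast
    have "\<exists>e>0. \<forall>q\<in>K. dist q p < e \<longrightarrow> point_over q \<in> U" if p: "p \<in> K" "point_over p \<in> U" for p
    proof -
      have "point_over p \<in> U'" using U'(2) p(2) by blast
      with U'(1) obtain e where e: "e > 0"
        "\<And>\<eta>. \<eta> \<in> completion \<Longrightarrow> completion_near rho e (point_over p) \<eta> \<Longrightarrow> \<eta> \<in> U'"
        unfolding completion_open_def by blast
      obtain k :: nat where k: "exp (- a * (real k - 1/2)) < e" using ex_exp_less[OF e(1)] by blast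
      have "point_over q \<in> U" if q: "q \<in> K" "dist q p < \<kappa> * t ^ k" for q
      proof -
        have "completion_near rho e (point_over p) (point_over q)"
          using dist_imp_near[OF p(1) q(1) _ k] q(2) by (simp add: dist_commute)
        then have "point_over q \<in> U'" using e(2) q(1) by (simp add: completion_eq)
        then show ?thesis using U'(2) q(1) by blast
      qed
      moreover have "\<kappa> * t ^ k > 0" using \<kappa> t by simp
      ultimately show ?thesis by blast
    qed
    then show "openin (top_of_set K) {p \<in> topspace (top_of_set K). point_over p \<in> U}"
      unfolding openin_euclidean_subtopology_iff by simp
  qed
  show "open_map (top_of_set K) (hyperbolic_boundary a V E root) point_over"
    unfolding open_map_def
  proof (intro allI impI)
    fix W assume W: "openin (top_of_set K) W"
    then have WK: "W \<subseteq> K" by (rule openin_imp_subset)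
    let ?U = "point_over ` W \<union> embed ` V"
    have "\<exists>e>0. \<forall>\<eta>\<in>completion. completion_near rho e \<xi> \<eta> \<longrightarrow> \<eta> \<in> ?U" if "\<xi> \<in> ?U" for \<xi>
      using that
    proof
      assume "\<xi> \<in> point_over ` W"
      then obtain p where p: "p \<in> W" "\<xi> = point_over p" by blast
      then obtain e where e: "e > 0" "\<And>q. q \<in> K \<Longrightarrow> dist q p < e \<Longrightarrow> q \<in> W"
        using W unfolding openin_euclidean_subtopology_iff by blast
      obtain G where G: "2 * drift * t ^ G < e" using ex_drift_less[OF e(1)] by blast
      have "\<eta> \<in> ?U" if \<eta>: "\<eta> \<in> completion" "completion_near rho (exp (- a * real G)) \<xi> \<eta>" for \<eta>
      proof (cases "\<eta> \<in> embed ` V")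
        case False
        then obtain q where q: "q \<in> K" "\<eta> = point_over q" using \<eta>(1) unfolding completion_eq by blast
        have "dist p q \<le> 2 * drift * t ^ G"
          using \<eta>(2) unfolding p(2) q(2) by (rule near_imp_dist)
        then have "q \<in> W" using e(2)[OF q(1)] G by (simp add: dist_commute)
        then show ?thesis using q by blast
      qed blast
      moreover have "exp (- a * real G) > 0" by simp
      ultimately show ?thesis by blast
    next
      assume "\<xi> \<in> embed ` V"
      then obtain v where v: "v \<in> V" "\<xi> = embed v" by blast
      have "\<eta> \<in> ?U" if "\<eta> \<in> completion" "completion_near rho (exp (- a * real (lev v))) \<xi> \<eta>" for \<eta>
        using near_embed[OF v(1) that(1) that(2)[unfolded v(2)]] v(1) by (simp only: UnI2 imageI)
      moreover have "exp (- a * real (lev v)) > 0" by simp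
      ultimately show ?thesis by blast
    qed
    moreover have "?U \<subseteq> completion" using WK unfolding completion_eq by blast
    ultimately have "completion_open V rho ?U" unfolding completion_open_def by simp
    moreover have "embed ` V \<inter> point_over ` K = {}"
      unfolding boundary_points[symmetric] by (rule Diff_disjoint)
    then have "point_over ` W = ?U \<inter> point_over ` K" using WK by blast
    ultimately show "openin (hyperbolic_boundary a V E root) (point_over ` W)"
      unfolding openin using \<open>completion_open V rho ?U\<close> by (intro exI[of _ ?U] conjI)
  qed
qed

end

section \<open>Boundary, self-similar set and horizontal components\<close>

lemma totally_disconnected_space_homeomorphic:
  assumes "homeomorphic_map X Y f"
  shows "totally_disconnected_space X \<longleftrightarrow> totally_disconnected_space Y"
proof -
  have Y: "topspace Y = f ` topspace X" and inj: "inj_on f (topspace X)"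
    using assms homeomorphic_imp_surjective_map homeomorphic_imp_injective_map by blast+
  have "connected_component_of_set Y (f x) = {f x} \<longleftrightarrow> connected_component_of_set X x = {x}"
    if x: "x \<in> topspace X" for x
  proof -
    have "f ` connected_component_of_set X x = f ` {x} \<longleftrightarrow> connected_component_of_set X x = {x}"
      using x by (intro inj_on_image_eq_iff[OF inj] connected_component_of_subset_topspace) simp
    then show ?thesis
      using homeomorphic_map_connected_component_of[OF assms x] by simp
  qed
  then show ?thesis unfolding totally_disconnected_space_def Y by simp
qed

lemma (in cell_graph_boundary) totally_disconnected_boundary_iff:
  "totally_disconnected_space (hyperbolic_boundary a V E root) \<longleftrightarrow>
    totally_disconnected_space (top_of_set K)"
  using totally_disconnected_space_homeomorphic[OF homeomorphic_boundary] by simp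

lemma (in cell_graph_boundary) totally_disconnected_iff_bounded_components:
  assumes "bounded_degree V E"
  shows "(totally_disconnected_space (hyperbolic_boundary a V E root) \<longleftrightarrow>
      bounded_horizontal_components L Eh) \<and>
    (totally_disconnected_space (top_of_set K) \<longleftrightarrow> bounded_horizontal_components L Eh)"
  using totally_disconnected_boundary_iff bounded_components_imp_totally_disconnected
    totally_disconnected_imp_bounded_components[OF assms] by blast

section \<open>The augmented tree and its quotient\<close>

lemma word_ratio_simps [simp]:
  "word_ratio r [] = 1" "word_ratio r (i # w) = r i * word_ratio r w"
  "word_ratio r (u @ v) = word_ratio r u * word_ratio r v"
  by (simp_all add: word_ratio_def)

lemma word_map_simps [simp]:
  "word_map S [] = id" "word_map S (i # w) = S i \<circ> word_map S w"
  by (simp_all add: word_map_def)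

lemma word_map_append: "word_map S (u @ v) = word_map S u \<circ> word_map S v"
  by (induction u) auto

lemma ex_stopping_prefix:
  fixes s :: real
  assumes "word_ratio r w \<le> s" "s < 1"
  shows "\<exists>u v. w = u @ v \<and> u \<noteq> [] \<and> word_ratio r u \<le> s \<and> s < word_ratio r (butlast u)"
  using assms(1)
proof (induction w rule: rev_induct)
  case Nil
  then show ?case using assms(2) by simp
next
  case (snoc i w)
  show ?case
  proof (cases "word_ratio r w \<le> s")
    case True
    then obtain u v where "w = u @ v" "u \<noteq> []" "word_ratio r u \<le> s" "s < word_ratio r (butlast u)"
      using snoc.IH by blast
    then show ?thesis by (intro exI[of _ u] exI[of _ "v @ [i]"]) simp
  next
    case False
    then show ?thesis using snoc.prems by (intro exI[of _ "w @ [i]"] exI[of _ "[]"]) simp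
  qed
qed

locale self_similar_IFS =
  fixes N :: nat and S :: "nat \<Rightarrow> 'a::euclidean_space \<Rightarrow> 'a" and r :: "nat \<Rightarrow> real"
    and K :: "'a set" and \<kappa> :: real
  assumes ifs: "similitude_IFS N S r" and self_similar: "self_similar_set N S K" and \<kappa>: "\<kappa> > 0"
begin

abbreviation t :: real where "t \<equiv> min_ratio N r"

abbreviation level :: "nat \<Rightarrow> nat list set" where "level \<equiv> aug_level N r"

lemma ratio: "i \<in> {1..N} \<Longrightarrow> 0 < r i" "i \<in> {1..N} \<Longrightarrow> r i < 1"
  and S_dist: "i \<in> {1..N} \<Longrightarrow> dist (S i p) (S i q) = r i * dist p q"
  and N: "1 \<le> N"
  using ifs unfolding similitude_IFS_def by blast+

lemma t_le: "i \<in> {1..N} \<Longrightarrow> t \<le> r i"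
  unfolding min_ratio_def by simp

lemma t: "0 < t" "t < 1"
proof -
  have "t \<in> r ` {1..N}" unfolding min_ratio_def using N by (intro Min_in) auto
  then obtain i where "i \<in> {1..N}" "t = r i" by blast
  then show "0 < t" "t < 1" using ratio by simp_all
qed

lemma word_ratio_pos: "set w \<subseteq> {1..N} \<Longrightarrow> word_ratio r w > 0"
  by (induction w) (auto intro!: mult_pos_pos ratio)

lemma word_map_dist:
  "set w \<subseteq> {1..N} \<Longrightarrow> dist (word_map S w p) (word_map S w q) = word_ratio r w * dist p q"
  by (induction w) (auto simp: S_dist)

lemma K: "compact K" "K \<noteq> {}" "K = (\<Union>i\<in>{1..N}. S i ` K)"
  using self_similar unfolding self_similar_set_def by blast+

lemma word_map_subset_K: "set w \<subseteq> {1..N} \<Longrightarrow> word_map S w ` K \<subseteq> K"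
proof (induction w)
  case (Cons i w)
  then have "S i ` (word_map S w ` K) \<subseteq> S i ` K" by (intro image_mono) simp
  also have "\<dots> \<subseteq> K" using Cons.prems by (subst (2) K(3)) auto
  finally show ?case by (simp add: image_comp)
qed simp

lemma ex_word: "p \<in> K \<Longrightarrow> \<exists>w. set w \<subseteq> {1..N} \<and> length w = l \<and> p \<in> word_map S w ` K"
proof (induction l arbitrary: p)
  case 0
  then show ?case by (intro exI[of _ "[]"]) simp
next
  case (Suc l)
  then obtain i q where i: "i \<in> {1..N}" "q \<in> K" "p = S i q" using K(3) by blast
  obtain w where "set w \<subseteq> {1..N}" "length w = l" "q \<in> word_map S w ` K"
    using Suc.IH[OF i(2)] by blast
  then show ?case using i by (intro exI[of _ "i # w"]) auto
qed

lemma ex_long_words_small: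
  assumes "e > 0" shows "\<exists>l. \<forall>w. set w \<subseteq> {1..N} \<and> length w = l \<longrightarrow> word_ratio r w \<le> e"
proof -
  define s where "s = Max (r ` {1..N})"
  have s: "r i \<le> s" if "i \<in> {1..N}" for i using that by (simp add: s_def)
  have "s \<in> r ` {1..N}" unfolding s_def using N by (intro Max_in) auto
  then obtain i where "i \<in> {1..N}" "s = r i" by blast
  then have s01: "0 < s" "s < 1" using ratio by simp_all
  have "word_ratio r w \<le> s ^ length w" if "set w \<subseteq> {1..N}" for w
    using that
  proof (induction w)
    case (Cons i w)
    then have "r i * word_ratio r w \<le> s * s ^ length w"
      using s s01 word_ratio_pos[of w] by (intro mult_mono) auto
    then show ?case by simp
  qed simp
  moreover obtain l where "s ^ l < e" using real_arch_pow_inv[OF assms s01(2)] by blast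
  ultimately show ?thesis by (intro exI[of _ l]) force
qed

lemma level_word: "x \<in> level n \<Longrightarrow> set x \<subseteq> {1..N}"
  by (auto simp: aug_level_def split: if_splits)

text \<open>
  The last letter contributes a factor of at least \<open>t\<close>, so the ratio of a word cannot fall from
  above \<open>t ^ n\<close> to \<open>t ^ Suc n\<close> or below in one letter.  In particular, the levels are disjoint.
\<close>

lemma level_ratio:
  assumes "x \<in> level n" shows "t ^ Suc n < word_ratio r x" "word_ratio r x \<le> t ^ n"
proof -
  show "word_ratio r x \<le> t ^ n"
    using assms by (auto simp: aug_level_def split: if_splits)
  show "t ^ Suc n < word_ratio r x"
  proof (cases "n = 0")
    case True
    then show ?thesis using assms t by (simp add: aug_level_def)
  next
    case False
    then have x: "x \<noteq> []" "t ^ n < word_ratio r (butlast x)"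
      using assms by (auto simp: aug_level_def)
    have last: "last x \<in> {1..N}" using last_in_set[OF x(1)] level_word[OF assms] by blast
    have "t ^ Suc n = t * t ^ n" by simp
    also have "\<dots> < t * word_ratio r (butlast x)" using x(2) t by simp
    also have "\<dots> \<le> r (last x) * word_ratio r (butlast x)"
      using t_le[OF last] x(2) zero_less_power[OF t(1), of n] by (intro mult_right_mono) linarith+
    also have "\<dots> = word_ratio r (butlast x @ [last x])"
      unfolding word_ratio_simps(3) by simp
    finally show ?thesis using x(1) by (simp only: append_butlast_last_id not_False_eq_True)
  qed
qed

lemma level_unique: "x \<in> level m \<Longrightarrow> x \<in> level n \<Longrightarrow> m = n"
proof (induction m n rule: linorder_wlog)
  case (le m n)
  show ?case
  proof (rule ccontr)
    assume "m \<noteq> n"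
    then have "t ^ n \<le> t ^ Suc m" using le t by (intro power_decreasing) auto
    then show False using level_ratio le by (meson leD le_less_trans less_le_trans)
  qed
qed auto

text \<open>
  Applied to long words that code a point of \<open>K\<close>, this shows that the cells of each level cover
  \<open>K\<close>; applied to a word of the next level, it gives the parent.
\<close>

lemma ex_level_prefix:
  assumes "set w \<subseteq> {1..N}" "word_ratio r w \<le> t ^ n"
  shows "\<exists>u\<in>level n. \<exists>v. w = u @ v"
proof (cases "n = 0")
  case True
  then show ?thesis by (simp add: aug_level_def)
next
  case False
  then have "t ^ n < 1" using t by (simp add: power_less_one_iff)
  then obtain u v where "w = u @ v" "u \<noteq> []" "word_ratio r u \<le> t ^ n"
    "t ^ n < word_ratio r (butlast u)"
    using ex_stopping_prefix assms(2) by blast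
  then show ?thesis using False assms(1) by (auto simp: aug_level_def)
qed

lemma cells_cover: "K = (\<Union>x\<in>level n. word_map S x ` K)"
proof
  show "(\<Union>x\<in>level n. word_map S x ` K) \<subseteq> K"
    using word_map_subset_K level_word by blast
  show "K \<subseteq> (\<Union>x\<in>level n. word_map S x ` K)"
  proof
    fix p assume p: "p \<in> K"
    have "t ^ n > 0" using t by simp
    then obtain l where l: "\<And>w. set w \<subseteq> {1..N} \<Longrightarrow> length w = l \<Longrightarrow> word_ratio r w \<le> t ^ n"
      using ex_long_words_small by blast
    obtain w where w: "set w \<subseteq> {1..N}" "length w = l" "p \<in> word_map S w ` K"
      using ex_word[OF p] by blast
    obtain u v where uv: "u \<in> level n" "w = u @ v" using ex_level_prefix[OF w(1) l[OF w(1,2)]] by blast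
    have "word_map S w ` K \<subseteq> word_map S u ` K"
      unfolding uv(2) word_map_append image_comp[symmetric]
      using word_map_subset_K[of v] w(1) uv(2) by (intro image_mono) simp
    then show "p \<in> (\<Union>x\<in>level n. word_map S x ` K)" using w(3) uv(1) by blast
  qed
qed

lemma ex_parent:
  assumes "y \<in> level (Suc n)" shows "\<exists>x\<in>level n. (x, y) \<in> aug_vert_edges N r"
proof -
  have "word_ratio r y \<le> t ^ n"
    using level_ratio(2)[OF assms] t by (elim order_trans) (simp add: power_le_one mult_left_le_one_le)
  then obtain x v where x: "x \<in> level n" "y = x @ v"
    using ex_level_prefix[OF level_word[OF assms]] by blast
  then have "prefix x y" by simp
  then have "(x, y) \<in> aug_vert_edges N r"
    using x(1) assms unfolding aug_vert_edges_def Let_def by blast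
  then show ?thesis using x(1) by blast
qed

lemma vert_edgeD:
  assumes "(x, y) \<in> aug_vert_edges N r"
  shows "\<exists>n. x \<in> level n \<and> y \<in> level (Suc n) \<and> word_map S y ` K \<subseteq> word_map S x ` K \<or>
    y \<in> level n \<and> x \<in> level (Suc n) \<and> word_map S x ` K \<subseteq> word_map S y ` K"
proof -
  have sub: "word_map S y ` K \<subseteq> word_map S x ` K" if xy: "prefix x y" "y \<in> level n" for x y n
  proof -
    obtain z where z: "y = x @ z" using xy(1) by (auto elim: prefixE)
    then show ?thesis
      using word_map_subset_K[of z] level_word[OF xy(2)]
      unfolding z word_map_append image_comp[symmetric] by (intro image_mono) simp
  qed
  then show ?thesis using assms unfolding aug_vert_edges_def Let_def by blast
qed

lemma sym_vert_edges: "sym (aug_vert_edges N r)"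
  unfolding aug_vert_edges_def Let_def by (simp add: sym_Un_converse)

lemma hor_edges_iff:
  "(x, y) \<in> aug_hor_edges N S r K \<kappa> \<longleftrightarrow>
    x \<noteq> y \<and> (\<exists>n. x \<in> level n \<and> y \<in> level n \<and>
      setdist (word_map S x ` K) (word_map S y ` K) \<le> \<kappa> * t ^ n)"
  by (simp add: aug_hor_edges_def)

lemma cell_similar:
  assumes "x \<in> level n"
  shows "\<exists>f s. word_map S x ` K = f ` K \<and> t ^ Suc n \<le> s \<and> s \<le> t ^ n \<and>
    (\<forall>p q. dist (f p) (f q) = s * dist p q)"
proof (intro exI conjI allI)
  show "t ^ Suc n \<le> word_ratio r x" using level_ratio(1)[OF assms] by simp
  show "word_ratio r x \<le> t ^ n" using level_ratio(2)[OF assms] .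
  show "dist (word_map S x p) (word_map S x q) = word_ratio r x * dist p q" for p q
    using word_map_dist[OF level_word[OF assms]] .
qed simp

lemma augmented_tree_cell_graph:
  "cell_graph level (\<lambda>x. word_map S x ` K) (aug_vert_edges N r) (aug_hor_edges N S r K \<kappa>) K \<kappa> t []"
proof
  show "level 0 = {[]}" by (simp add: aug_level_def)
qed (fact K(1,2) t \<kappa> level_unique cell_similar cells_cover hor_edges_iff sym_vert_edges
    vert_edgeD ex_parent)+

abbreviation cls :: "nat list \<Rightarrow> nat list set" where "cls x \<equiv> aug_rel N S r `` {x}"

abbreviation qlevel :: "nat \<Rightarrow> nat list set set" where "qlevel \<equiv> quot_level N S r"

lemma cls_eq: "x \<in> level n \<Longrightarrow> cls x = {y \<in> level n. word_map S y = word_map S x}"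
  unfolding aug_rel_def using level_unique by auto

lemma cls_self: "x \<in> level n \<Longrightarrow> x \<in> cls x"
  using cls_eq by auto

lemma qlevel_iff: "C \<in> qlevel n \<longleftrightarrow> (\<exists>x\<in>level n. C = cls x)"
  unfolding quot_level_def quotient_def by blast

lemma mem_qlevel:
  assumes "C \<in> qlevel n" "x \<in> C" shows "x \<in> level n \<and> C = cls x"
proof -
  obtain y where y: "y \<in> level n" "C = cls y" using assms(1) unfolding qlevel_iff by blast
  then have x: "x \<in> level n" "word_map S x = word_map S y"
    using assms(2) cls_eq[OF y(1)] by auto
  then show ?thesis using cls_eq[OF x(1)] cls_eq[OF y(1)] y(2) by simp
qed

lemma qlevel_unique: "C \<in> qlevel m \<Longrightarrow> C \<in> qlevel n \<Longrightarrow> m = n"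
  using mem_qlevel cls_self level_unique unfolding qlevel_iff by metis

lemma quot_verts_eq: "quot_verts N S r = (\<Union>n. qlevel n)"
  unfolding quot_verts_def aug_verts_def quot_level_def quotient_def by blast

text \<open>The members of a class have the same map, so the choice of one of them does not matter.\<close>

definition qcell :: "nat list set \<Rightarrow> 'a set" where
  "qcell C = word_map S (SOME x. x \<in> C) ` K"

lemma qcell_cls:
  assumes "x \<in> level n" shows "qcell (cls x) = word_map S x ` K"
proof -
  have "(SOME y. y \<in> cls x) \<in> cls x" by (rule someI[of _ x]) (rule cls_self[OF assms])
  then have "word_map S (SOME y. y \<in> cls x) = word_map S x" using cls_eq[OF assms] by simp
  then show ?thesis unfolding qcell_def by simp
qed

lemma qcell: "C \<in> qlevel n \<Longrightarrow> x \<in> C \<Longrightarrow> qcell C = word_map S x ` K"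
  using mem_qlevel qcell_cls by metis

lemma qlevelD_rep:
  assumes "C \<in> quot_verts N S r" "x \<in> C" "x \<in> level n"
  shows "C \<in> qlevel n" "qcell C = word_map S x ` K"
proof -
  obtain k where k: "C \<in> qlevel k" using assms(1) unfolding quot_verts_eq by blast
  then have "k = n" using mem_qlevel[OF k assms(2)] assms(3) level_unique by blast
  then show "C \<in> qlevel n" using k by simp
  then show "qcell C = word_map S x ` K" using assms(2) by (rule qcell)
qed

lemma induced_edge_cls:
  assumes "(x, y) \<in> F" "x \<in> level m" "y \<in> level n" "cls x \<noteq> cls y"
  shows "(cls x, cls y) \<in> induced_edges (quot_verts N S r) F"
proof -
  have "cls x \<in> quot_verts N S r" "cls y \<in> quot_verts N S r"
    unfolding quot_verts_eq using assms(2,3) qlevel_iff by auto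
  then show ?thesis
    unfolding induced_edges_def using assms(1,4) cls_self[OF assms(2)] cls_self[OF assms(3)] by blast
qed

lemma quotient_cell_graph:
  "cell_graph qlevel qcell (quot_vert_edges N S r) (quot_hor_edges N S r K \<kappa>) K \<kappa> t
    (quot_root N S r)"
proof
  show "qlevel 0 = {quot_root N S r}"
    unfolding quot_level_def quot_root_def by (simp add: aug_level_def quotient_def)
  show "\<exists>f s. qcell C = f ` K \<and> t ^ Suc n \<le> s \<and> s \<le> t ^ n \<and>
      (\<forall>p q. dist (f p) (f q) = s * dist p q)" if C: "C \<in> qlevel n" for C n
  proof -
    obtain x where x: "x \<in> level n" "C = cls x" using C unfolding qlevel_iff by blast
    show ?thesis unfolding x(2) qcell_cls[OF x(1)] by (rule cell_similar[OF x(1)])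
  qed
  show "K = (\<Union>C\<in>qlevel n. qcell C)" for n
  proof -
    have "qlevel n = cls ` level n" unfolding quot_level_def quotient_def by blast
    then have "(\<Union>C\<in>qlevel n. qcell C) = (\<Union>x\<in>level n. qcell (cls x))"
      by (simp only: image_image)
    also have "\<dots> = (\<Union>x\<in>level n. word_map S x ` K)" by (simp add: qcell_cls)
    also have "\<dots> = K" by (rule cells_cover[symmetric])
    finally show ?thesis by (rule sym)
  qed
  show "(C, D) \<in> quot_hor_edges N S r K \<kappa> \<longleftrightarrow> C \<noteq> D \<and>
      (\<exists>n. C \<in> qlevel n \<and> D \<in> qlevel n \<and> setdist (qcell C) (qcell D) \<le> \<kappa> * t ^ n)" for C D
  proof
    assume "(C, D) \<in> quot_hor_edges N S r K \<kappa>"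
    then obtain x y where C: "C \<noteq> D" "C \<in> quot_verts N S r" "D \<in> quot_verts N S r" "x \<in> C" "y \<in> D"
      and xy: "(x, y) \<in> aug_hor_edges N S r K \<kappa>"
      unfolding quot_hor_edges_def induced_edges_def by blast
    obtain n where n: "x \<in> level n" "y \<in> level n"
      "setdist (word_map S x ` K) (word_map S y ` K) \<le> \<kappa> * t ^ n"
      using xy unfolding hor_edges_iff by blast
    show "C \<noteq> D \<and>
        (\<exists>n. C \<in> qlevel n \<and> D \<in> qlevel n \<and> setdist (qcell C) (qcell D) \<le> \<kappa> * t ^ n)"
      using C(1) n(3) qlevelD_rep[OF C(2,4) n(1)] qlevelD_rep[OF C(3,5) n(2)] by auto
  next
    assume "C \<noteq> D \<and>
      (\<exists>n. C \<in> qlevel n \<and> D \<in> qlevel n \<and> setdist (qcell C) (qcell D) \<le> \<kappa> * t ^ n)"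
    then obtain n where n: "C \<noteq> D" "C \<in> qlevel n" "D \<in> qlevel n"
      "setdist (qcell C) (qcell D) \<le> \<kappa> * t ^ n" by blast
    obtain x y where xy: "x \<in> level n" "C = cls x" "y \<in> level n" "D = cls y"
      using n(2,3) unfolding qlevel_iff by blast
    have "(x, y) \<in> aug_hor_edges N S r K \<kappa>"
      unfolding hor_edges_iff
      using n(1,4) xy(1,3) unfolding xy(2,4) qcell_cls[OF xy(1)] qcell_cls[OF xy(3)] by blast
    from induced_edge_cls[OF this xy(1,3)] show "(C, D) \<in> quot_hor_edges N S r K \<kappa>"
      unfolding quot_hor_edges_def using n(1) xy(2,4) by simp
  qed
  show "sym (quot_vert_edges N S r)"
    using sym_vert_edges unfolding quot_vert_edges_def induced_edges_def sym_def by blast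
  show "\<exists>n. C \<in> qlevel n \<and> D \<in> qlevel (Suc n) \<and> qcell D \<subseteq> qcell C \<or>
      D \<in> qlevel n \<and> C \<in> qlevel (Suc n) \<and> qcell C \<subseteq> qcell D"
    if CD: "(C, D) \<in> quot_vert_edges N S r" for C D
  proof -
    obtain x y where C: "C \<in> quot_verts N S r" "D \<in> quot_verts N S r" "x \<in> C" "y \<in> D"
      and xy: "(x, y) \<in> aug_vert_edges N r"
      using CD unfolding quot_vert_edges_def induced_edges_def by blast
    from vert_edgeD[OF xy] show ?thesis
    proof (elim exE disjE conjE)
      fix n assume "x \<in> level n" "y \<in> level (Suc n)" "word_map S y ` K \<subseteq> word_map S x ` K"
      then show ?thesis
        using qlevelD_rep[OF C(1,3), of n] qlevelD_rep[OF C(2,4), of "Suc n"] by auto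
    next
      fix n assume "y \<in> level n" "x \<in> level (Suc n)" "word_map S x ` K \<subseteq> word_map S y ` K"
      then show ?thesis
        using qlevelD_rep[OF C(1,3), of "Suc n"] qlevelD_rep[OF C(2,4), of n] by auto
    qed
  qed
  show "\<exists>C\<in>qlevel n. (C, D) \<in> quot_vert_edges N S r" if D: "D \<in> qlevel (Suc n)" for D n
  proof -
    obtain y where y: "y \<in> level (Suc n)" "D = cls y" using D unfolding qlevel_iff by blast
    obtain x where x: "x \<in> level n" "(x, y) \<in> aug_vert_edges N r" using ex_parent[OF y(1)] by blast
    have C: "cls x \<in> qlevel n" using x(1) unfolding qlevel_iff by blast
    then have "cls x \<noteq> cls y" using qlevel_unique[OF C] D y(2) n_not_Suc_n by metis
    with x y(1) have "(cls x, D) \<in> quot_vert_edges N S r"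
      unfolding quot_vert_edges_def y(2) by (intro induced_edge_cls)
    then show ?thesis using C by blast
  qed
qed (fact K(1,2) t \<kappa> qlevel_unique)+

end

theorem theorem1p4:
  fixes N :: nat and S :: "nat \<Rightarrow> real ^ 'd \<Rightarrow> real ^ 'd" and r :: "nat \<Rightarrow> real"
    and K :: "(real ^ 'd) set" and \<kappa> a :: real
  assumes "similitude_IFS N S r" and "self_similar_set N S K" and "\<kappa> > 0" and "a > 0"
  shows
   "(bounded_degree (aug_verts N r) (aug_edges N S r K \<kappa>) \<longrightarrow>
      (totally_disconnected_space
          (hyperbolic_boundary a (aug_verts N r) (aug_edges N S r K \<kappa>) [])
        \<longleftrightarrow> bounded_horizontal_components (aug_level N r) (aug_hor_edges N S r K \<kappa>)) \<and>
      (totally_disconnected_space (top_of_set K)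
        \<longleftrightarrow> bounded_horizontal_components (aug_level N r) (aug_hor_edges N S r K \<kappa>)))
    \<and>
    (bounded_degree (quot_verts N S r) (quot_edges N S r K \<kappa>) \<longrightarrow>
      (totally_disconnected_space
          (hyperbolic_boundary a (quot_verts N S r) (quot_edges N S r K \<kappa>) (quot_root N S r))
        \<longleftrightarrow> bounded_horizontal_components (quot_level N S r) (quot_hor_edges N S r K \<kappa>)) \<and>
      (totally_disconnected_space (top_of_set K)
        \<longleftrightarrow> bounded_horizontal_components (quot_level N S r) (quot_hor_edges N S r K \<kappa>)))"
proof -
  interpret self_similar_IFS N S r K \<kappa>
    by unfold_locales (fact assms)+
  interpret X: cell_graph_boundary "aug_level N r" "\<lambda>x. word_map S x ` K" "aug_vert_edges N r"
    "aug_hor_edges N S r K \<kappa>" K \<kappa> "min_ratio N r" "[]" a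
    by (intro cell_graph_boundary.intro augmented_tree_cell_graph
        cell_graph_boundary_axioms.intro assms(4))
  interpret Q: cell_graph_boundary "quot_level N S r" qcell "quot_vert_edges N S r"
    "quot_hor_edges N S r K \<kappa>" K \<kappa> "min_ratio N r" "quot_root N S r" a
    by (intro cell_graph_boundary.intro quotient_cell_graph
        cell_graph_boundary_axioms.intro assms(4))
  show ?thesis
    unfolding aug_verts_def aug_edges_def quot_verts_eq quot_edges_def
    by (intro conjI[OF impI impI] X.totally_disconnected_iff_bounded_components
        Q.totally_disconnected_iff_bounded_components)
qed

end
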